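(* Let $\mathcal M=\{M_0,\dots,M_{s-1}\}$ be a finite nonempty set of $2\times 2$ nonnegative column-allowable real matrices, $\mathcal S=\{0,1,\dots,s-1\}$, and let $V=\begin{pmatrix} v_1 \\ v_2 \end{pmatrix}$ with $v_1,v_2>0$. For $\omega=(\omega_n)_{n\ge 1}\in\mathcal S^{\mathbb N}$ put $P_n(\omega)=M_{\omega_1}M_{\omega_2}\cdots M_{\omega_n}$. Then the sequence of vectors $\mathtt N(P_n(\omega)V)$ converges, as $n\to\infty$, uniformly for $\omega\in\mathcal S^{\mathbb N}$ if and only if at least one of the following five cases holds (in each implication the letters stand for arbitrary nonnegative reals such that the displayed matrix belongs to $\mathcal M$): Case 1: $\begin{pmatrix} a & b \\ 0 & d \end{pmatrix}\in\mathcal M\Rightarrow a\ge d$; $\begin{pmatrix} a & 0 \\ c & d \end{pmatrix}\in\mathcal M\Rightarrow a\le d$; $\begin{pmatrix} a & b \\ c & 0 \end{pmatrix},\begin{pmatrix} 0 & b' \\ c' & d' \end{pmatrix}\in\mathcal M\Rightarrow bc'\ge b'c$; and no matrix in $\mathcal M$ has the form $\begin{pmatrix} a & 0 \\ 0 & d \end{pmatrix}$ or $\begin{pmatrix} 0 & b \\ c & 0 \end{pmatrix}$. Case 2: $\begin{pmatrix} a & b \\ 0 & d \end{pmatrix}\in\mathcal M\Rightarrow a<d$; $\begin{pmatrix} a & 0 \\ c & d \end{pmatrix}\in\mathcal M\Rightarrow a>d$; $\begin{pmatrix} a & b \\ c & 0 \end{pmatrix},\begin{pmatrix} 0 & b'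 \\ c' & d' \end{pmatrix}\in\mathcal M\Rightarrow bc'<b'c$. Case 3: $\begin{pmatrix} a & b \\ 0 & d \end{pmatrix}\in\mathcal M\Rightarrow a\ge d$; $\begin{pmatrix} a & 0 \\ c & d \end{pmatrix}\in\mathcal M\Rightarrow a>d$; and no matrix in $\mathcal M$ has the form $\begin{pmatrix} 0 & b \\ c & d \end{pmatrix}$. Case 4: $\begin{pmatrix} a & b \\ 0 & d \end{pmatrix}\in\mathcal M\Rightarrow a<d$; $\begin{pmatrix} a & 0 \\ c & d \end{pmatrix}\in\mathcal M\Rightarrow a\le d$; and no matrix in $\mathcal M$ has the form $\begin{pmatrix} a & b \\ c & 0 \end{pmatrix}$. Case 5: $V$ is an eigenvector of all the matrices in $\mathcal M$.
   Context: A matrix $A=\begin{pmatrix} a & b \\ c & d \end{pmatrix}$ is nonnegative if $a,b,c,d\ge 0$, and column-allowable if it has no null column, i.e. $a+c>0$ and $b+d>0$. For a nonnegative nonzero vector $X=\begin{pmatrix} x_1 \\ x_2 \end{pmatrix}$, the normalized vector is $\mathtt N(X):=\frac{1}{x_1+x_2}\begin{pmatrix} x_1 \\ x_2 \end{pmatrix}$. Uniform convergence means uniform convergence on $\mathcal S^{\mathbb N}$ of the sequence of functions $\omega\mapsto\mathtt N(P_n(\omega)V)$. In the displayed matrix forms, the entries denoted by letters may be zero (so, for instance, a diagonal matrix is both of the form $\begin{pmatrix} a & b \\ 0 & d \end{pmatrix}$ and of the form $\begin{pmatrix} a & 0 \\ c & d \end{pmatrix}$). *)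

theory Defs
  imports "HOL-Analysis.Analysis"
begin

text \<open>The matrix with rows \<open>(a, b)\<close> and \<open>(c, d)\<close>.\<close>

definition mat2 :: "real \<Rightarrow> real \<Rightarrow> real \<Rightarrow> real \<Rightarrow> real^2^2" where
  "mat2 a b c d = vector [vector [a, b], vector [c, d]]"

definition nonneg_matrix :: "real^2^2 \<Rightarrow> bool" where
  "nonneg_matrix A \<longleftrightarrow> (\<forall>i j. 0 \<le> A $ i $ j)"

definition column_allowable :: "real^2^2 \<Rightarrow> bool" where
  "column_allowable A \<longleftrightarrow> (\<forall>j. column j A \<noteq> 0)"

definition normalized :: "real^2 \<Rightarrow> real^2" where
  "normalized X = (1 / (X $ 1 + X $ 2)) *\<^sub>R X"

definition eigenvector :: "real^2^2 \<Rightarrow> real^2 \<Rightarrow> bool" where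
  "eigenvector A v \<longleftrightarrow> v \<noteq> 0 \<and> (\<exists>k. A *v v = k *\<^sub>R v)"

text \<open>\<open>mprod M \<omega> n\<close> is \<open>M (\<omega> 1) ** M (\<omega> 2) ** \<dots> ** M (\<omega> n)\<close>; the value \<open>\<omega> 0\<close> is not used.\<close>

primrec mprod :: "(nat \<Rightarrow> real^2^2) \<Rightarrow> (nat \<Rightarrow> nat) \<Rightarrow> nat \<Rightarrow> real^2^2" where
  "mprod M \<omega> 0 = mat 1"
| "mprod M \<omega> (Suc n) = mprod M \<omega> n ** M (\<omega> (Suc n))"

text \<open>
  The predicates below are used for sets \<open>S\<close> of nonnegative matrices, so the quantified entries
  are automatically nonnegative reals. They may be zero: one matrix may match several of the
  displayed forms, and both members of a pair of forms may be the same matrix.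
\<close>

definition case1 :: "(real^2^2) set \<Rightarrow> bool" where
  "case1 S \<longleftrightarrow>
     (\<forall>a b d. mat2 a b 0 d \<in> S \<longrightarrow> a \<ge> d) \<and>
     (\<forall>a c d. mat2 a 0 c d \<in> S \<longrightarrow> a \<le> d) \<and>
     (\<forall>a b c b' c' d'. mat2 a b c 0 \<in> S \<and> mat2 0 b' c' d' \<in> S \<longrightarrow> b * c' \<ge> b' * c) \<and>
     (\<forall>a d. mat2 a 0 0 d \<notin> S) \<and>
     (\<forall>b c. mat2 0 b c 0 \<notin> S)"

definition case2 :: "(real^2^2) set \<Rightarrow> bool" where
  "case2 S \<longleftrightarrow>
     (\<forall>a b d. mat2 a b 0 d \<in> S \<longrightarrow> a < d) \<and>
     (\<forall>a c d. mat2 a 0 c d \<in> S \<longrightarrow> a > d) \<and>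
     (\<forall>a b c b' c' d'. mat2 a b c 0 \<in> S \<and> mat2 0 b' c' d' \<in> S \<longrightarrow> b * c' < b' * c)"

definition case3 :: "(real^2^2) set \<Rightarrow> bool" where
  "case3 S \<longleftrightarrow>
     (\<forall>a b d. mat2 a b 0 d \<in> S \<longrightarrow> a \<ge> d) \<and>
     (\<forall>a c d. mat2 a 0 c d \<in> S \<longrightarrow> a > d) \<and>
     (\<forall>b c d. mat2 0 b c d \<notin> S)"

definition case4 :: "(real^2^2) set \<Rightarrow> bool" where
  "case4 S \<longleftrightarrow>
     (\<forall>a b d. mat2 a b 0 d \<in> S \<longrightarrow> a < d) \<and>
     (\<forall>a c d. mat2 a 0 c d \<in> S \<longrightarrow> a \<le> d) \<and>
     (\<forall>a b c. mat2 a b c 0 \<notin> S)"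

definition case5 :: "(real^2^2) set \<Rightarrow> real^2 \<Rightarrow> bool" where
  "case5 S V \<longleftrightarrow> (\<forall>A\<in>S. eigenvector A V)"

end

(*
  In the coordinate t = x1 / (x1 + x2) a column-allowable matrix acts on [0, 1] by a monotone Moebius
  map, and uniform convergence becomes a Cauchy condition on finite words over the set of matrices.

  Sufficiency. The projective distance "gap" is not increased by any nonnegative matrix, and a factor
  below 1 is gained as soon as the relevant entries are positive. In case 2 all matrices preserve a
  compact subinterval of (0, 1) on which they contract. In cases 1 and 3 a sequence either contains
  infinitely many contracting pairs, or from some point on it consists of matrices which push towards
  one of the axes, at a rate which is linear in the coordinate r = t / (1 - t) or 1 / r. In both cases
  the nested images of the interval shrink to a point; by Koenig's lemma they shrink uniformly.
  Case 4 is case 3 with the coordinates exchanged.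

  Necessity. A word acting as the identity forces all matrices to fix V. A word whose product fixes
  the first axis as a repelling point is incompatible with words that send V arbitrarily close to that
  axis. Applied to upper triangular matrices and to products of a matrix with lower right entry 0 and
  one with upper left entry 0, this excludes everything but the listed cases.
*)
theory Submission
  imports Defs
begin

subsection \<open>Finite families and words\<close>

text \<open>The gap alone cannot prove shrinking: it equals \<open>1\<close> between an axis and any
  point off it, and every triangular matrix fixes an axis. So progress towards an axis is measured
  separately, where no contraction is available. Contraction is attributed to two consecutive
  factors because a matrix with a zero entry contracts only at points bounded away from an axis; the
  factor to its right, which acts just before it, supplies this bound. In the coordinate
  \<open>r\<close> the matrix with entries \<open>a, b, c, 0\<close> sends \<open>r\<close> to
  \<open>a / c + (b / c) / r\<close>, and the one with entries \<open>0, b', c', d'\<close> sends it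
  to the inverse of \<open>(c' / b') r + d' / b'\<close>. If closeness to the second axis is
  measured by \<open>k / r\<close>, then both advance by a constant as soon as
  \<open>b' / c' \<le> k \<le> b / c\<close>. The inequality on pairs in case 1 provides such a
  \<open>k\<close>; its strict reverse in case 2 provides a \<open>k\<close> for which the interval
  from \<open>e\<close> to \<open>k / e\<close> is preserved.\<close>

lemma finite_uniform_parameter:
  fixes P :: "'a \<Rightarrow> real \<Rightarrow> bool"
  assumes "finite S"
    and "\<And>A d d'. A \<in> S \<Longrightarrow> P A d \<Longrightarrow> 0 < d' \<Longrightarrow> d' \<le> d \<Longrightarrow> P A d'"
    and "\<And>A. A \<in> S \<Longrightarrow> \<exists>d>0. P A d"
  shows "\<exists>d>0. d < 1 \<and> (\<forall>A\<in>S. P A d)"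
  using assms
proof (induction S rule: finite_induct)
  case empty
  show ?case by (rule exI[of _ "1/2"]) simp
next
  case (insert A S)
  have "\<exists>d>0. d < 1 \<and> (\<forall>B\<in>S. P B d)"
    by (rule insert.IH) (use insert.prems in \<open>blast+\<close>)
  then obtain d where d: "0 < d" "d < 1" "\<forall>B\<in>S. P B d" by blast
  obtain d' where d': "0 < d'" "P A d'" using insert.prems(2) by blast
  have "P B (min d d')" if "B \<in> insert A S" for B
  proof (cases "B = A")
    case True
    show ?thesis unfolding True by (rule insert.prems(1)[of A d']) (use d d' in auto)
  next
    case False
    show ?thesis by (rule insert.prems(1)[of B d]) (use d d' that False in auto)
  qed
  then show ?case using d d' by (intro exI[of _ "min d d'"]) auto
qed

text \<open>The number \<open>k\<close> will be a threshold between two families of ratios of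
  entries. If \<open>Y\<close> is empty, nothing bounds it from above, and inserting
  \<open>1\<close> makes it positive.\<close>

lemma separate_finite_sets:
  fixes X Y :: "real set"
  assumes "finite X" "finite Y" "\<And>y. y \<in> Y \<Longrightarrow> 0 < y"
    and le: "\<And>x y. x \<in> X \<Longrightarrow> y \<in> Y \<Longrightarrow> x \<le> y"
  obtains k where "0 < k" "\<And>x. x \<in> X \<Longrightarrow> x \<le> k" "\<And>y. y \<in> Y \<Longrightarrow> k \<le> y"
proof (cases "Y = {}")
  case True
  show ?thesis
  proof (rule that[of "Max (insert 1 X)"])
    show "0 < Max (insert 1 X)"
      using Max_ge[of "insert 1 X" 1] assms(1) by (smt (verit) finite_insert insertI1)
  qed (use True assms(1) in auto)
next
  case False
  show ?thesis by (rule that[of "Min Y"]) (use False assms in auto)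
qed

lemma separate_finite_sets_strict:
  fixes X Y :: "real set"
  assumes "finite X" "finite Y" "\<And>y. y \<in> Y \<Longrightarrow> 0 < y"
    and less: "\<And>x y. x \<in> X \<Longrightarrow> y \<in> Y \<Longrightarrow> x < y"
  obtains k where "0 < k" "\<And>x. x \<in> X \<Longrightarrow> x < k" "\<And>y. y \<in> Y \<Longrightarrow> k < y"
proof -
  \<comment> \<open>With \<open>0\<close> inserted, the midpoint between \<open>l\<close> and
    \<open>Min Y\<close> is positive.\<close>
  define l where "l = Max (insert 0 X)"
  have l: "x \<le> l" if "x \<in> insert 0 X" for x
    unfolding l_def using that assms(1) by (intro Max_ge) auto
  have "l \<in> insert 0 X" unfolding l_def using assms(1) by (intro Max_in) auto
  then have ly: "l < y" if "y \<in> Y" for y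
    using that less assms(3) by auto
  show ?thesis
  proof (cases "Y = {}")
    case True
    show ?thesis by (rule that[of "l + 1"]) (use True l in \<open>force+\<close>)
  next
    case False
    have m: "Min Y \<in> Y" "\<And>y. y \<in> Y \<Longrightarrow> Min Y \<le> y" using False assms(2) by auto
    show ?thesis
    proof (rule that[of "(l + Min Y) / 2"])
      show "0 < (l + Min Y) / 2" using l[of 0] ly[OF m(1)] by simp
    next
      fix x assume "x \<in> X" then show "x < (l + Min Y) / 2" using l[of x] ly[OF m(1)] by simp
    next
      fix y assume "y \<in> Y" then show "(l + Min Y) / 2 < y" using m(2)[of y] ly[OF m(1)] by simp
    qed
  qed
qed

lemma foldr_invariant:
  assumes "\<And>A x. A \<in> S \<Longrightarrow> x \<in> K \<Longrightarrow> f A x \<in> K" "u \<in> lists S" "x \<in> K"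
  shows "foldr f u x \<in> K"
  using assms(2) by (induction u) (auto intro: assms)

text \<open>The word tree is finitely branching, so by Koenig's lemma shrinking along every infinite
  path is automatically uniform.\<close>

lemma words_shrink_uniformly:
  fixes f :: "'a \<Rightarrow> 'b::metric_space \<Rightarrow> 'b"
  assumes fin: "finite S" and inv: "\<And>A x. A \<in> S \<Longrightarrow> x \<in> K \<Longrightarrow> f A x \<in> K"
    and shrink: "\<And>\<omega>. (\<And>n. \<omega> n \<in> S) \<Longrightarrow>
      \<exists>n. \<forall>x\<in>K. \<forall>y\<in>K. dist (foldr f (map \<omega> [0..<n]) x) (foldr f (map \<omega> [0..<n]) y) < e"
  shows "\<exists>N. \<forall>u\<in>lists S. N \<le> length u \<longrightarrow> (\<forall>x\<in>K. \<forall>y\<in>K. dist (foldr f u x) (foldr f u y) < e)"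
proof (rule ccontr)
  define small where "small u \<longleftrightarrow> (\<forall>x\<in>K. \<forall>y\<in>K. dist (foldr f u x) (foldr f u y) < e)" for u
  define good where "good u \<longleftrightarrow> (\<exists>N. \<forall>w\<in>lists S. N \<le> length w \<longrightarrow> small (u @ w))" for u
  assume "\<not> ?thesis"
  then have bad: "\<not> good []" by (simp add: good_def small_def)
  \<comment> \<open>A longer word applies the same outer maps to points that are again in
    \<open>K\<close>.\<close>
  have small_append: "small (u @ w)" if "small u" "w \<in> lists S" for u w
    using that foldr_invariant[of S K f w] inv unfolding small_def by simp
  have ext: "\<exists>A\<in>S. \<not> good (u @ [A])" if "\<not> good u" for u
  proof (rule ccontr)
    assume "\<not> ?thesis"
    then have "\<forall>A\<in>S. \<exists>N. \<forall>w\<in>lists S. N \<le> length w \<longrightarrow> small (u @ [A] @ w)"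
      by (simp add: good_def)
    then obtain N where N: "\<And>A w. A \<in> S \<Longrightarrow> w \<in> lists S \<Longrightarrow> N A \<le> length w \<Longrightarrow> small (u @ [A] @ w)"
      by metis
    \<comment> \<open>The extra \<open>Suc\<close> makes \<open>w\<close> nonempty; after removal of
      its first letter \<open>A\<close> the length is still at least \<open>N A\<close>.\<close>
    have "small (u @ w)" if w: "w \<in> lists S" "Suc (\<Sum>A\<in>S. N A) \<le> length w" for w
    proof (cases w)
      case Nil
      then show ?thesis using w by simp
    next
      case (Cons A w')
      have "N A \<le> (\<Sum>A\<in>S. N A)" using Cons w fin by (intro member_le_sum) auto
      then show ?thesis using N[of A w'] Cons w by simp
    qed
    then have "good u" unfolding good_def by blast
    with that show False by simp
  qed
  define nxt where "nxt u = (SOME A. A \<in> S \<and> \<not> good (u @ [A]))" for u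
  have nxt: "nxt u \<in> S \<and> \<not> good (u @ [nxt u])" if "\<not> good u" for u
    unfolding nxt_def using someI_ex[of "\<lambda>A. A \<in> S \<and> \<not> good (u @ [A])"] ext[OF that] by blast
  define g where "g = rec_nat [] (\<lambda>_ u. u @ [nxt u])"
  have g: "g 0 = []" "g (Suc n) = g n @ [nxt (g n)]" for n by (simp_all add: g_def)
  have g_bad: "\<not> good (g n)" for n by (induction n) (use g bad nxt in auto)
  have g_map: "g n = map (\<lambda>n. nxt (g n)) [0..<n]" for n by (induction n) (simp_all add: g)
  have "nxt (g n) \<in> S" for n using nxt g_bad by blast
  from shrink[of "\<lambda>n. nxt (g n)", OF this] obtain n where "small (g n)"
    unfolding small_def g_map[symmetric] by blast
  then have "good (g n)" unfolding good_def using small_append by blast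
  with g_bad show False by blast
qed

subsection \<open>The action on the unit interval\<close>

definition admissible :: "real^2^2 \<Rightarrow> bool" where
  "admissible A \<longleftrightarrow> nonneg_matrix A \<and> column_allowable A"

lemma admissible_iff:
  "admissible A \<longleftrightarrow> 0 \<le> A$1$1 \<and> 0 \<le> A$1$2 \<and> 0 \<le> A$2$1 \<and> 0 \<le> A$2$2
     \<and> 0 < A$1$1 + A$2$1 \<and> 0 < A$1$2 + A$2$2"
  unfolding admissible_def nonneg_matrix_def column_allowable_def column_def
  by (auto simp: forall_2 vec_eq_iff)

lemma mat2_nth [simp]:
  "mat2 a b c d $ 1 $ 1 = a" "mat2 a b c d $ 1 $ 2 = b"
  "mat2 a b c d $ 2 $ 1 = c" "mat2 a b c d $ 2 $ 2 = d"
  by (simp_all add: mat2_def)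

lemma mat2_eta: "mat2 (A$1$1) (A$1$2) (A$2$1) (A$2$2) = A"
  by (simp add: vec_eq_iff forall_2)

text \<open>The action of a matrix on the normalized vectors \<open>(t, 1 - t)\<close>, read off on the first coordinate.\<close>

definition mass :: "real^2^2 \<Rightarrow> real \<Rightarrow> real" where
  "mass A t = (A$1$1 + A$2$1) * t + (A$1$2 + A$2$2) * (1 - t)"

definition act :: "real^2^2 \<Rightarrow> real \<Rightarrow> real" where
  "act A t = (A$1$1 * t + A$1$2 * (1 - t)) / mass A t"

lemma mass_pos:
  assumes "admissible A" "t \<in> {0..1}"
  shows "0 < mass A t"
proof (cases "t = 0")
  case True
  then show ?thesis using assms by (simp add: mass_def admissible_iff)
next
  case False
  then have "0 < (A$1$1 + A$2$1) * t" "0 \<le> (A$1$2 + A$2$2) * (1 - t)"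
    using assms by (simp_all add: admissible_iff)
  then show ?thesis by (simp add: mass_def)
qed

lemma one_minus_act:
  assumes "admissible A" "t \<in> {0..1}"
  shows "1 - act A t = (A$2$1 * t + A$2$2 * (1 - t)) / mass A t"
  using mass_pos[OF assms] by (simp add: act_def field_simps) (simp add: mass_def algebra_simps)

lemma act_in_unit:
  assumes "admissible A" "t \<in> {0..1}"
  shows "act A t \<in> {0..1}"
proof -
  have "0 \<le> act A t" using assms mass_pos[OF assms] by (simp add: act_def admissible_iff)
  moreover have "0 \<le> 1 - act A t"
    unfolding one_minus_act[OF assms] using assms mass_pos[OF assms] by (simp add: admissible_iff)
  ultimately show ?thesis by simp
qed

lemma act_diff:
  assumes "admissible A" "x \<in> {0..1}" "y \<in> {0..1}"
  shows "act A x - act A y = (A$1$1 * A$2$2 - A$1$2 * A$2$1) * (x - y) / (mass A x * mass A y)"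
  using mass_pos[OF assms(1,2)] mass_pos[OF assms(1,3)]
  by (simp add: act_def field_simps) (simp add: mass_def algebra_simps)

lemma continuous_on_act: "admissible A \<Longrightarrow> continuous_on {0..1} (act A)"
  unfolding act_def mass_def
  by (intro continuous_intros) (use mass_pos[of A] in \<open>force simp: mass_def\<close>)

lemma matrix_mult_entries:
  fixes A B :: "real^2^2"
  shows "(A ** B)$i$j = A$i$1 * B$1$j + A$i$2 * B$2$j"
  by (simp add: matrix_matrix_mult_def sum_2)

text \<open>Normalizing in between is harmless, since the masses of the successive steps multiply to
  the mass of the product.\<close>

lemma act_mult:
  assumes "admissible A" "admissible B" "t \<in> {0..1}"
  shows "act (A ** B) t = act A (act B t)"
proof -
  have m: "0 < mass B t" "0 < mass A (act B t)"
    using assms mass_pos act_in_unit by blast+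
  have p: "act B t * mass B t = B$1$1 * t + B$1$2 * (1 - t)"
    using m(1) by (simp add: act_def)
  have q: "(1 - act B t) * mass B t = B$2$1 * t + B$2$2 * (1 - t)"
    using m(1) by (simp add: one_minus_act[OF assms(2,3)])
  have "mass A (act B t) * mass B t
      = (A$1$1 + A$2$1) * (act B t * mass B t) + (A$1$2 + A$2$2) * ((1 - act B t) * mass B t)"
    by (simp add: mass_def[of A] algebra_simps)
  also have "\<dots> = mass (A ** B) t"
    unfolding p q by (simp add: mass_def matrix_mult_entries algebra_simps)
  finally have "mass (A ** B) t = mass A (act B t) * mass B t" ..
  moreover have "(A ** B)$1$1 * t + (A ** B)$1$2 * (1 - t)
      = (A$1$1 * act B t + A$1$2 * (1 - act B t)) * mass B t"
  proof -
    have "(A$1$1 * act B t + A$1$2 * (1 - act B t)) * mass B t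
        = A$1$1 * (act B t * mass B t) + A$1$2 * ((1 - act B t) * mass B t)"
      by (simp add: algebra_simps)
    then show ?thesis unfolding p q by (simp add: matrix_mult_entries algebra_simps)
  qed
  ultimately show ?thesis using m by (simp add: act_def[of "A ** B"] act_def[of A])
qed

text \<open>In terms of \<open>r = x / (1 - x)\<close> this is \<open>\<bar>r - r'\<bar> / (r + r')\<close>, the hyperbolic tangent of half
  Hilbert's projective distance. It is \<open>0\<close> at \<open>x = y = 0\<close> and \<open>x = y = 1\<close>, where the denominator vanishes.\<close>

definition gap :: "real \<Rightarrow> real \<Rightarrow> real" where
  "gap x y = \<bar>x - y\<bar> / (x * (1 - y) + y * (1 - x))"

lemma gap_denominator:
  fixes x y :: real
  assumes "x \<in> {0..1}" "y \<in> {0..1}"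
  shows "\<bar>x - y\<bar> \<le> x * (1 - y) + y * (1 - x)" "x * (1 - y) + y * (1 - x) \<le> 1"
proof -
  have "0 \<le> x * (1 - y)" "0 \<le> y * (1 - x)" "0 \<le> x * y" "0 \<le> (1 - x) * (1 - y)" using assms by auto
  then show "\<bar>x - y\<bar> \<le> x * (1 - y) + y * (1 - x)" "x * (1 - y) + y * (1 - x) \<le> 1"
    by (simp_all add: abs_le_iff algebra_simps)
qed

lemma gap_bounds:
  assumes "x \<in> {0..1}" "y \<in> {0..1}"
  shows "0 \<le> gap x y" "gap x y \<le> 1" "\<bar>x - y\<bar> \<le> gap x y"
proof -
  note D = gap_denominator[OF assms]
  show "0 \<le> gap x y" using D(1) by (auto simp: gap_def)
  show "gap x y \<le> 1" using D(1) by (auto simp: gap_def divide_le_eq_1)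
  show "\<bar>x - y\<bar> \<le> gap x y"
  proof (cases "x = y")
    case False
    then have "0 < x * (1 - y) + y * (1 - x)" using D(1) by (smt (verit))
    then show ?thesis using mult_left_mono[OF D(2), of "\<bar>x - y\<bar>"] by (simp add: gap_def field_simps)
  qed (simp add: gap_def)
qed

text \<open>The masses cancel. The new denominator is the permanent times the old denominator plus a
  nonnegative extra term; contraction comes from a determinant smaller than the permanent in
  absolute value, or from the extra term.\<close>

lemma gap_act:
  assumes "admissible A" "x \<in> {0..1}" "y \<in> {0..1}"
  shows "gap (act A x) (act A y) = \<bar>A$1$1 * A$2$2 - A$1$2 * A$2$1\<bar> * \<bar>x - y\<bar> /
    ((A$1$1 * A$2$2 + A$1$2 * A$2$1) * (x * (1 - y) + y * (1 - x))
      + 2 * (A$1$1 * A$2$1 * (x * y) + A$1$2 * A$2$2 * ((1 - x) * (1 - y))))"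
proof -
  have m: "0 < mass A x" "0 < mass A y" using assms mass_pos by blast+
  have "\<bar>act A x - act A y\<bar> = \<bar>A$1$1 * A$2$2 - A$1$2 * A$2$1\<bar> * \<bar>x - y\<bar> / (mass A x * mass A y)"
    unfolding act_diff[OF assms] using m by (simp add: abs_mult)
  moreover have "act A x * (1 - act A y) + act A y * (1 - act A x) =
      ((A$1$1 * x + A$1$2 * (1 - x)) * (A$2$1 * y + A$2$2 * (1 - y))
        + (A$1$1 * y + A$1$2 * (1 - y)) * (A$2$1 * x + A$2$2 * (1 - x))) / (mass A x * mass A y)"
    unfolding one_minus_act[OF assms(1,2)] one_minus_act[OF assms(1,3)] unfolding act_def
    by (simp only: times_divide_times_eq add_divide_distrib[symmetric] mult.commute[of "mass A y"])
  moreover have "(A$1$1 * x + A$1$2 * (1 - x)) * (A$2$1 * y + A$2$2 * (1 - y))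
        + (A$1$1 * y + A$1$2 * (1 - y)) * (A$2$1 * x + A$2$2 * (1 - x))
      = (A$1$1 * A$2$2 + A$1$2 * A$2$1) * (x * (1 - y) + y * (1 - x))
      + 2 * (A$1$1 * A$2$1 * (x * y) + A$1$2 * A$2$2 * ((1 - x) * (1 - y)))"
    by (simp add: algebra_simps)
  ultimately show ?thesis using m by (simp add: gap_def)
qed

text \<open>The old denominator is at most \<open>1\<close>, so a constant lower bound
  \<open>g\<close> of the extra term also bounds it below by \<open>g\<close> times the old
  denominator. The comparison then concerns the entries only.\<close>

lemma gap_act_le:
  assumes "admissible A" "x \<in> {0..1}" "y \<in> {0..1}" "0 \<le> l" "0 \<le> g"
    and g: "g \<le> 2 * (A$1$1 * A$2$1 * (x * y) + A$1$2 * A$2$2 * ((1 - x) * (1 - y)))"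
    and l: "\<bar>A$1$1 * A$2$2 - A$1$2 * A$2$1\<bar> \<le> l * (A$1$1 * A$2$2 + A$1$2 * A$2$1 + g)"
  shows "gap (act A x) (act A y) \<le> l * gap x y"
proof -
  define E F G P where "E = \<bar>A$1$1 * A$2$2 - A$1$2 * A$2$1\<bar>" and "F = A$1$1 * A$2$2 + A$1$2 * A$2$1"
    and "G = 2 * (A$1$1 * A$2$1 * (x * y) + A$1$2 * A$2$2 * ((1 - x) * (1 - y)))"
    and "P = x * (1 - y) + y * (1 - x)"
  have P: "\<bar>x - y\<bar> \<le> P" "P \<le> 1" unfolding P_def using gap_denominator assms by blast+
  have F: "0 \<le> F" using assms(1) by (simp add: F_def admissible_iff)
  have G: "g \<le> G" using g by (simp add: G_def)
  have eq: "gap (act A x) (act A y) = E * \<bar>x - y\<bar> / (F * P + G)"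
    unfolding gap_act[OF assms(1-3)] E_def F_def G_def P_def ..
  show ?thesis
  \<comment> \<open>In the degenerate cases the left side is \<open>0\<close>: its numerator
    vanishes, or the division is by zero.\<close>
  proof (cases "P = 0 \<or> F * P + G = 0")
    case True
    have "0 \<le> l * gap x y" using assms gap_bounds by simp
    then show ?thesis using True P by (auto simp: eq)
  next
    case False
    have P0: "0 < P" using False P by (smt (verit))
    have "0 \<le> F * P + G" using F P0 G assms(5) by simp
    then have pos: "0 < F * P + G" using False by simp
    have "E * P \<le> l * (F + g) * P" using l P0 by (simp add: E_def F_def)
    also have "\<dots> = l * (F * P + g * P)" by (simp add: algebra_simps)
    also have "\<dots> \<le> l * (F * P + G)"
      using G mult_left_mono[OF P(2) assms(5)] assms(4) by (intro mult_left_mono) auto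
    finally have "\<bar>x - y\<bar> * (E * P) \<le> \<bar>x - y\<bar> * (l * (F * P + G))" by (intro mult_left_mono) auto
    then have "E * \<bar>x - y\<bar> / (F * P + G) \<le> l * (\<bar>x - y\<bar> / P)"
      using pos P0 by (simp add: field_simps)
    then show ?thesis unfolding eq gap_def[of x y] P_def .
  qed
qed

lemma abs_det_le:
  assumes "admissible A"
  shows "\<bar>A$1$1 * A$2$2 - A$1$2 * A$2$1\<bar> \<le> A$1$1 * A$2$2 + A$1$2 * A$2$1"
proof -
  have "0 \<le> A$1$1 * A$2$2" "0 \<le> A$1$2 * A$2$1" using assms by (simp_all add: admissible_iff)
  then show ?thesis by linarith
qed

lemma gap_act_nonexpansive:
  assumes "admissible A" "x \<in> {0..1}" "y \<in> {0..1}"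
  shows "gap (act A x) (act A y) \<le> gap x y"
proof -
  have "gap (act A x) (act A y) \<le> 1 * gap x y"
    by (rule gap_act_le[where g = 0])
      (use assms abs_det_le in \<open>auto simp: admissible_iff intro!: mult_nonneg_nonneg add_nonneg_nonneg\<close>)
  then show ?thesis by simp
qed

subsection \<open>Contracting and advancing sequences\<close>

text \<open>With \<open>foldr\<close> the first letter of a word acts last, as in the matrix
  product. Appending \<open>w\<close> therefore only replaces the innermost argument
  \<open>t\<close> by another point of its orbit.\<close>

definition word_cauchy :: "(real^2^2) set \<Rightarrow> real \<Rightarrow> bool" where
  "word_cauchy S t \<longleftrightarrow> (\<forall>e>0. \<exists>N. \<forall>u\<in>lists S. \<forall>w\<in>lists S. N \<le> length u \<longrightarrow>
     \<bar>foldr act (u @ w) t - foldr act u t\<bar> < e)"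

definition shrinking :: "real set \<Rightarrow> (nat \<Rightarrow> real^2^2) \<Rightarrow> bool" where
  "shrinking K \<omega> \<longleftrightarrow> (\<forall>e>0. \<exists>n. \<forall>x\<in>K. \<forall>y\<in>K.
     \<bar>foldr act (map \<omega> [0..<n]) x - foldr act (map \<omega> [0..<n]) y\<bar> < e)"

lemma word_cauchyI:
  assumes "finite S" "\<And>A x. A \<in> S \<Longrightarrow> x \<in> K \<Longrightarrow> act A x \<in> K" "t \<in> K"
    and "\<And>\<omega>. (\<And>n. \<omega> n \<in> S) \<Longrightarrow> shrinking K \<omega>"
  shows "word_cauchy S t"
  unfolding word_cauchy_def
proof (intro allI impI)
  fix e :: real assume "0 < e"
  then obtain N where N: "\<forall>u\<in>lists S. N \<le> length u \<longrightarrow>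
      (\<forall>x\<in>K. \<forall>y\<in>K. dist (foldr act u x) (foldr act u y) < e)"
    using words_shrink_uniformly[of S K act e] assms unfolding shrinking_def dist_real_def by blast
  have "foldr act w t \<in> K" if "w \<in> lists S" for w
    using foldr_invariant[of S K act] assms that by blast
  with N assms(3) show "\<exists>N. \<forall>u\<in>lists S. \<forall>w\<in>lists S. N \<le> length u \<longrightarrow>
      \<bar>foldr act (u @ w) t - foldr act u t\<bar> < e"
    unfolding dist_real_def by (intro exI[of _ N]) simp
qed

text \<open>Uniform continuity absorbs an additional outermost matrix. The gap would not do here, as
  it can stay \<open>1\<close> between points that are arbitrarily close.\<close>

lemma shrinking_Suc:
  assumes "admissible (\<omega> 0)" "K \<subseteq> {0..1}" "\<And>n x. x \<in> K \<Longrightarrow> act (\<omega> n) x \<in> K"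
    and "shrinking K (\<lambda>n. \<omega> (Suc n))"
  shows "shrinking K \<omega>"
  unfolding shrinking_def
proof (intro allI impI)
  fix e :: real assume "0 < e"
  have "uniformly_continuous_on {0..1} (act (\<omega> 0))"
    using continuous_on_act[OF assms(1)] by (intro compact_uniformly_continuous) auto
  then obtain d where d: "0 < d"
    "\<And>x y. x \<in> {0..1} \<Longrightarrow> y \<in> {0..1} \<Longrightarrow> \<bar>y - x\<bar> < d \<Longrightarrow> \<bar>act (\<omega> 0) y - act (\<omega> 0) x\<bar> < e"
    using \<open>0 < e\<close> unfolding uniformly_continuous_on_def dist_real_def by meson
  let ?f = "\<lambda>n. foldr act (map (\<lambda>n. \<omega> (Suc n)) [0..<n])"
  obtain n where n: "\<And>x y. x \<in> K \<Longrightarrow> y \<in> K \<Longrightarrow> \<bar>?f n x - ?f n y\<bar> < d"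
    using assms(4) d(1) unfolding shrinking_def by blast
  have "?f n x \<in> K" if "x \<in> K" for x
    by (rule foldr_invariant[of "range \<omega>"]) (use assms(3) that in auto)
  then have "\<bar>act (\<omega> 0) (?f n x) - act (\<omega> 0) (?f n y)\<bar> < e" if "x \<in> K" "y \<in> K" for x y
    using that assms(2) n by (intro d(2)) blast+
  then show "\<exists>n. \<forall>x\<in>K. \<forall>y\<in>K.
     \<bar>foldr act (map \<omega> [0..<n]) x - foldr act (map \<omega> [0..<n]) y\<bar> < e"
    by (intro exI[of _ "Suc n"]) (simp add: map_upt_Suc del: upt_Suc)
qed

lemma shrinking_shift:
  assumes "\<And>n. admissible (\<omega> n)" "K \<subseteq> {0..1}" "\<And>n x. x \<in> K \<Longrightarrow> act (\<omega> n) x \<in> K"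
    and "shrinking K (\<lambda>n. \<omega> (n + k))"
  shows "shrinking K \<omega>"
  using assms
proof (induction k arbitrary: \<omega>)
  case (Suc k)
  have "shrinking K (\<lambda>n. \<omega> (Suc n))"
    by (rule Suc.IH) (use Suc.prems in auto)
  then show ?case by (rule shrinking_Suc[rotated 3]) (use Suc.prems in auto)
qed simp

definition contracting :: "real set \<Rightarrow> real \<Rightarrow> real^2^2 \<Rightarrow> real^2^2 \<Rightarrow> bool" where
  "contracting K l A B \<longleftrightarrow>
     (\<forall>x\<in>K. \<forall>y\<in>K. gap (act A (act B x)) (act A (act B y)) \<le> l * gap x y)"

text \<open>The image of \<open>B\<close> provides the bound \<open>g\<close> on the extra term in
  the denominator of the gap; the quotient of determinant and permanent plus \<open>g\<close> is
  then the contraction factor.\<close>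

lemma ex_contracting:
  assumes "admissible A" "admissible B" "K \<subseteq> {0..1}" "0 \<le> g"
    and g: "\<And>x y. x \<in> K \<Longrightarrow> y \<in> K \<Longrightarrow> g \<le> 2 * (A$1$1 * A$2$1 * (act B x * act B y)
      + A$1$2 * A$2$2 * ((1 - act B x) * (1 - act B y)))"
    and l: "A$1$1 * A$2$2 = A$1$2 * A$2$1 \<or>
      \<bar>A$1$1 * A$2$2 - A$1$2 * A$2$1\<bar> < A$1$1 * A$2$2 + A$1$2 * A$2$1 + g"
  shows "\<exists>d>0. contracting K (1 - d) A B"
proof -
  define E F where "E = \<bar>A$1$1 * A$2$2 - A$1$2 * A$2$1\<bar>" and "F = A$1$1 * A$2$2 + A$1$2 * A$2$1"
  have F: "0 \<le> F" using assms(1) by (simp add: F_def admissible_iff)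
  \<comment> \<open>A singular \<open>A\<close> reduces every gap to \<open>0\<close>. It is treated
    apart because \<open>F + g\<close> may then vanish.\<close>
  define d where "d = (if E = 0 then 1 else 1 - E / (F + g))"
  have d: "0 < d" "0 \<le> 1 - d" "E \<le> (1 - d) * (F + g)"
  proof -
    have "E = 0 \<or> 0 < F + g \<and> E < F + g"
      using l F assms(4) unfolding E_def F_def by force
    moreover have "0 \<le> E" by (simp add: E_def)
    ultimately show "0 < d" "0 \<le> 1 - d" "E \<le> (1 - d) * (F + g)" by (auto simp: d_def)
  qed
  have "gap (act A (act B x)) (act A (act B y)) \<le> (1 - d) * gap x y" if xy: "x \<in> K" "y \<in> K" for x y
  proof -
    have x: "x \<in> {0..1}" "y \<in> {0..1}" using xy assms(3) by blast+
    have "gap (act A (act B x)) (act A (act B y)) \<le> (1 - d) * gap (act B x) (act B y)"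
      by (rule gap_act_le[OF assms(1) _ _ d(2) assms(4) g[OF xy]])
        (use x act_in_unit[OF assms(2)] d(3) in \<open>auto simp: E_def F_def\<close>)
    also have "\<dots> \<le> (1 - d) * gap x y"
      using d(2) by (intro mult_left_mono gap_act_nonexpansive assms(2) x)
    finally show ?thesis .
  qed
  then show ?thesis using d(1) unfolding contracting_def by blast
qed

lemma ex_contracting_positive:
  assumes "admissible A" "admissible B" "K \<subseteq> {0..1}"
    and "0 < A$1$1" "0 < A$1$2" "0 < A$2$1" "0 < A$2$2"
  shows "\<exists>d>0. contracting K (1 - d) A B"
proof (rule ex_contracting[where g = 0])
  have "0 < A$1$1 * A$2$2" "0 < A$1$2 * A$2$1" using assms by simp_all
  then show "A$1$1 * A$2$2 = A$1$2 * A$2$1 \<or>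
      \<bar>A$1$1 * A$2$2 - A$1$2 * A$2$1\<bar> < A$1$1 * A$2$2 + A$1$2 * A$2$1 + 0"
    by linarith
  fix x y assume "x \<in> K" "y \<in> K"
  then have "act B x \<in> {0..1}" "act B y \<in> {0..1}" using act_in_unit assms(2,3) by blast+
  then show "0 \<le> 2 * (A$1$1 * A$2$1 * (act B x * act B y) + A$1$2 * A$2$2 * ((1 - act B x) * (1 - act B y)))"
    using assms by (auto intro!: add_nonneg_nonneg)
qed (use assms in auto)

text \<open>Images under \<open>B\<close> with first coordinate at least \<open>\<eta>\<close> keep
  the part of the extra term that belongs to the first column of \<open>A\<close> above a positive
  constant.\<close>

lemma ex_contracting_row1:
  assumes adm: "admissible A" "admissible B" and K: "K \<subseteq> {0..1}"
    and \<eta>: "0 < \<eta>" "\<And>x. x \<in> K \<Longrightarrow> \<eta> \<le> act B x"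
    and A: "A$1$1 * A$2$2 = A$1$2 * A$2$1 \<or> 0 < A$1$1 * A$2$1"
  shows "\<exists>d>0. contracting K (1 - d) A B"
proof (rule ex_contracting[OF adm K, where g = "2 * (A$1$1 * A$2$1 * (\<eta> * \<eta>))"])
  show "0 \<le> 2 * (A$1$1 * A$2$1 * (\<eta> * \<eta>))" using \<eta> adm(1) by (simp add: admissible_iff)
  show "A$1$1 * A$2$2 = A$1$2 * A$2$1 \<or> \<bar>A$1$1 * A$2$2 - A$1$2 * A$2$1\<bar>
      < A$1$1 * A$2$2 + A$1$2 * A$2$1 + 2 * (A$1$1 * A$2$1 * (\<eta> * \<eta>))"
  proof (cases "A$1$1 * A$2$2 = A$1$2 * A$2$1")
    case False
    then have "0 < A$1$1 * A$2$1 * (\<eta> * \<eta>)" using A \<eta>(1) by simp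
    then show ?thesis using abs_det_le[OF adm(1)] by linarith
  qed simp
  fix x y assume xy: "x \<in> K" "y \<in> K"
  then have u: "act B x \<in> {0..1}" "act B y \<in> {0..1}" using act_in_unit adm(2) K by blast+
  have "\<eta> * \<eta> \<le> act B x * act B y" using \<eta> xy by (intro mult_mono) (auto intro: less_imp_le order_trans)
  then have "A$1$1 * A$2$1 * (\<eta> * \<eta>) \<le> A$1$1 * A$2$1 * (act B x * act B y)"
    using adm(1) by (intro mult_left_mono) (auto simp: admissible_iff)
  moreover have "0 \<le> A$1$2 * A$2$2 * ((1 - act B x) * (1 - act B y))"
    using adm(1) u by (auto simp: admissible_iff)
  ultimately show "2 * (A$1$1 * A$2$1 * (\<eta> * \<eta>)) \<le> 2 * (A$1$1 * A$2$1 * (act B x * act B y)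
      + A$1$2 * A$2$2 * ((1 - act B x) * (1 - act B y)))" by simp
qed

text \<open>The counterpart for the second coordinate and the second column of
  \<open>A\<close>.\<close>

lemma ex_contracting_row2:
  assumes adm: "admissible A" "admissible B" and K: "K \<subseteq> {0..1}"
    and \<eta>: "0 < \<eta>" "\<And>x. x \<in> K \<Longrightarrow> \<eta> \<le> 1 - act B x"
    and A: "A$1$1 * A$2$2 = A$1$2 * A$2$1 \<or> 0 < A$1$2 * A$2$2"
  shows "\<exists>d>0. contracting K (1 - d) A B"
proof (rule ex_contracting[OF adm K, where g = "2 * (A$1$2 * A$2$2 * (\<eta> * \<eta>))"])
  show "0 \<le> 2 * (A$1$2 * A$2$2 * (\<eta> * \<eta>))" using \<eta> adm(1) by (simp add: admissible_iff)
  show "A$1$1 * A$2$2 = A$1$2 * A$2$1 \<or> \<bar>A$1$1 * A$2$2 - A$1$2 * A$2$1\<bar>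
      < A$1$1 * A$2$2 + A$1$2 * A$2$1 + 2 * (A$1$2 * A$2$2 * (\<eta> * \<eta>))"
  proof (cases "A$1$1 * A$2$2 = A$1$2 * A$2$1")
    case False
    then have "0 < A$1$2 * A$2$2 * (\<eta> * \<eta>)" using A \<eta>(1) by simp
    then show ?thesis using abs_det_le[OF adm(1)] by linarith
  qed simp
  fix x y assume xy: "x \<in> K" "y \<in> K"
  then have u: "act B x \<in> {0..1}" "act B y \<in> {0..1}" using act_in_unit adm(2) K by blast+
  have "\<eta> * \<eta> \<le> (1 - act B x) * (1 - act B y)"
    using \<eta>(1) \<eta>(2)[OF xy(1)] \<eta>(2)[OF xy(2)] by (intro mult_mono) auto
  then have "A$1$2 * A$2$2 * (\<eta> * \<eta>) \<le> A$1$2 * A$2$2 * ((1 - act B x) * (1 - act B y))"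
    using adm(1) by (intro mult_left_mono) (auto simp: admissible_iff)
  moreover have "0 \<le> A$1$1 * A$2$1 * (act B x * act B y)"
    using adm(1) u by (auto simp: admissible_iff)
  ultimately show "2 * (A$1$2 * A$2$2 * (\<eta> * \<eta>)) \<le> 2 * (A$1$1 * A$2$1 * (act B x * act B y)
      + A$1$2 * A$2$2 * ((1 - act B x) * (1 - act B y)))" by simp
qed

text \<open>Every contracting pair contributes a factor \<open>l\<close>, and the matrices in
  between do not increase the gap.\<close>

lemma shrinking_if_contracting:
  assumes adm: "\<And>n. admissible (\<omega> n)" and K: "K \<subseteq> {0..1}" "\<And>n x. x \<in> K \<Longrightarrow> act (\<omega> n) x \<in> K"
    and l: "0 \<le> l" "l < 1" and inf: "\<exists>\<^sub>\<infinity>n. contracting K l (\<omega> n) (\<omega> (Suc n))"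
  shows "shrinking K \<omega>"
proof -
  let ?f = "\<lambda>i j. foldr act (map \<omega> [i..<j])"
  have f_in: "?f i j x \<in> K" if "x \<in> K" for i j x
    by (rule foldr_invariant[of "range \<omega>"]) (use K(2) that in auto)
  have f_gap: "gap (?f i j x) (?f i j y) \<le> gap x y" if "x \<in> K" "y \<in> K" for i j x y
  proof (induction "j - i" arbitrary: i)
    case (Suc m)
    then have ij: "[i..<j] = i # [Suc i..<j]" by (simp add: upt_conv_Cons)
    have "gap (?f i j x) (?f i j y) \<le> gap (?f (Suc i) j x) (?f (Suc i) j y)"
      unfolding ij list.map foldr.simps comp_apply
      by (intro gap_act_nonexpansive adm K(1)[THEN subsetD] f_in that)
    also have "\<dots> \<le> gap x y" by (rule Suc.hyps(1)) (use Suc.hyps(2) in simp)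
    finally show ?case .
  qed simp
  have "\<exists>n. \<forall>x\<in>K. \<forall>y\<in>K. gap (?f 0 n x) (?f 0 n y) \<le> l ^ m * gap x y" for m
  proof (induction m)
    case 0
    show ?case by (rule exI[of _ 0]) simp
  next
    case (Suc m)
    then obtain n where n: "\<And>x y. x \<in> K \<Longrightarrow> y \<in> K \<Longrightarrow> gap (?f 0 n x) (?f 0 n y) \<le> l ^ m * gap x y"
      by blast
    obtain k where k: "n \<le> k" "contracting K l (\<omega> k) (\<omega> (Suc k))"
      using inf unfolding INFM_nat_le by blast
    \<comment> \<open>Taking \<open>k\<close> beyond the prefix already used keeps the counted pairs
      disjoint.\<close>
    have split: "[0..<Suc (Suc k)] = [0..<n] @ [n..<k] @ [k, Suc k]"
      using k(1) upt_add_eq_append[of 0 n "k - n"] by simp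
    have "gap (?f 0 (Suc (Suc k)) x) (?f 0 (Suc (Suc k)) y) \<le> l ^ Suc m * gap x y"
      if xy: "x \<in> K" "y \<in> K" for x y
    proof -
      let ?x = "act (\<omega> k) (act (\<omega> (Suc k)) x)" and ?y = "act (\<omega> k) (act (\<omega> (Suc k)) y)"
      have K': "?x \<in> K" "?y \<in> K" using K(2) xy by auto
      have "gap (?f 0 (Suc (Suc k)) x) (?f 0 (Suc (Suc k)) y)
          = gap (?f 0 n (?f n k ?x)) (?f 0 n (?f n k ?y))"
        unfolding split by simp
      also have "\<dots> \<le> l ^ m * gap (?f n k ?x) (?f n k ?y)" by (intro n f_in K')
      also have "\<dots> \<le> l ^ m * gap ?x ?y" using l f_gap[OF K'] by (intro mult_left_mono) auto
      also have "\<dots> \<le> l ^ m * (l * gap x y)"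
        using l k(2) xy unfolding contracting_def by (intro mult_left_mono) auto
      finally show ?thesis by (simp add: mult_ac)
    qed
    then show ?case by blast
  qed
  note powers = this
  show ?thesis unfolding shrinking_def
  proof (intro allI impI)
    fix e :: real assume "0 < e"
    then obtain m where m: "l ^ m < e" using real_arch_pow_inv l by blast
    obtain n where n: "\<And>x y. x \<in> K \<Longrightarrow> y \<in> K \<Longrightarrow> gap (?f 0 n x) (?f 0 n y) \<le> l ^ m * gap x y"
      using powers by blast
    have "\<bar>?f 0 n x - ?f 0 n y\<bar> < e" if "x \<in> K" "y \<in> K" for x y
    proof -
      have "\<bar>?f 0 n x - ?f 0 n y\<bar> \<le> gap (?f 0 n x) (?f 0 n y)"
        by (intro gap_bounds K(1)[THEN subsetD] f_in that)
      also have "\<dots> \<le> l ^ m * gap x y" using n that by blast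
      also have "\<dots> \<le> l ^ m * 1" using l by (intro mult_left_mono gap_bounds K(1)[THEN subsetD] that) auto
      finally show ?thesis using m by simp
    qed
    then show "\<exists>n. \<forall>x\<in>K. \<forall>y\<in>K. \<bar>?f 0 n x - ?f 0 n y\<bar> < e" by blast
  qed
qed

text \<open>For \<open>r = t / (1 - t)\<close> the condition reads \<open>r \<ge> x\<close> (near the first axis, side \<open>True\<close>)
  or \<open>r \<le> k / x\<close> (near the second axis, side \<open>False\<close>).\<close>

definition near :: "real \<Rightarrow> bool \<Rightarrow> real \<Rightarrow> real \<Rightarrow> bool" where
  "near k p x t \<longleftrightarrow> (if p then x * (1 - t) \<le> t else x * t \<le> k * (1 - t))"

text \<open>The argument is near the axis \<open>p\<close>, its image near the axis
  \<open>q\<close>. The gain \<open>d\<close> does not depend on \<open>x\<close>, so gains add up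
  along a sequence even if the axes alternate.\<close>

definition advancing :: "real set \<Rightarrow> real \<Rightarrow> real \<Rightarrow> bool \<Rightarrow> bool \<Rightarrow> real^2^2 \<Rightarrow> bool" where
  "advancing K k d p q A \<longleftrightarrow>
     (\<forall>x\<ge>0. \<forall>t\<in>K. near k p x t \<longrightarrow> near k q (x + d) (act A t))"

lemma near_antimono:
  assumes "near k p x t" "y \<le> x" "t \<in> {0..1}"
  shows "near k p y t"
proof -
  have "y * (1 - t) \<le> x * (1 - t)" "y * t \<le> x * t"
    using assms by (auto intro: mult_right_mono)
  then show ?thesis using assms(1) by (auto simp: near_def)
qed

text \<open>Side \<open>True\<close> bounds \<open>1 - t\<close> by \<open>1 / (1 + x)\<close>, side
  \<open>False\<close> bounds \<open>t\<close> by \<open>k / (k + x)\<close>; the constant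
  \<open>max 1 k\<close> serves both.\<close>

lemma near_diff:
  assumes "near k p x t" "near k p x t'" "t \<in> {0..1}" "t' \<in> {0..1}" "0 < k" "0 \<le> x"
  shows "\<bar>t - t'\<bar> \<le> max 1 k / (max 1 k + x)"
proof (cases p)
  case True
  have le: "1 - s \<le> max 1 k / (max 1 k + x)" if "near k p x s" "s \<in> {0..1}" for s
  proof -
    have "(1 - s) * 1 \<le> (1 - s) * max 1 k" using that(2) by (intro mult_left_mono) auto
    moreover have "s * 1 \<le> s * max 1 k" using that(2) by (intro mult_left_mono) auto
    moreover have "x * (1 - s) \<le> s" using that True by (simp add: near_def)
    ultimately have "(1 - s) * (max 1 k + x) \<le> max 1 k" by (simp add: algebra_simps)
    then show ?thesis using assms by (simp add: pos_le_divide_eq)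
  qed
  show ?thesis using le[OF assms(1,3)] le[OF assms(2,4)] assms(3,4) by auto
next
  case False
  have le: "s \<le> max 1 k / (max 1 k + x)" if "near k p x s" "s \<in> {0..1}" for s
  proof -
    have "(1 - s) * k \<le> (1 - s) * max 1 k" using that(2) by (intro mult_left_mono) auto
    moreover have "x * s \<le> k * (1 - s)" using that False by (simp add: near_def)
    ultimately have "s * (max 1 k + x) \<le> max 1 k" by (simp add: algebra_simps)
    then show ?thesis using assms by (simp add: pos_le_divide_eq)
  qed
  show ?thesis using le[OF assms(1,3)] le[OF assms(2,4)] assms(3,4) by auto
qed

text \<open>With parameter \<open>0\<close> every point is near either axis, and each matrix from
  the inside outwards adds \<open>d\<close>. All images thus end up close to the same axis
  \<open>p 0\<close>.\<close>

lemma shrinking_if_advancing: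
  assumes K: "K \<subseteq> {0..1}" "\<And>n x. x \<in> K \<Longrightarrow> act (\<omega> n) x \<in> K" and "0 < k" "0 < d"
    and adv: "\<And>n. advancing K k d (p (Suc n)) (p n) (\<omega> n)"
  shows "shrinking K \<omega>"
proof -
  let ?f = "\<lambda>i j. foldr act (map \<omega> [i..<j])"
  have f_in: "?f i j x \<in> K" if "x \<in> K" for i j x
    by (rule foldr_invariant[of "range \<omega>"]) (use K(2) that in auto)
  have near: "near k (p m) (of_nat n * d) (?f m (m + n) t)" if t: "t \<in> K" for m n t
  proof (induction n arbitrary: m)
    case 0
    then show ?case using t K(1) assms(3) by (auto simp: near_def)
  next
    case (Suc n)
    have "near k (p m) (of_nat n * d + d) (act (\<omega> m) (?f (Suc m) (Suc m + n) t))"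
      using adv[of m] Suc.IH[of "Suc m"] f_in[OF t] assms(4) unfolding advancing_def
      by (simp del: upt_Suc)
    moreover have "[m..<m + Suc n] = m # [Suc m..<Suc m + n]" by (simp add: upt_conv_Cons)
    ultimately show ?case by (simp add: algebra_simps)
  qed
  show ?thesis unfolding shrinking_def
  proof (intro allI impI)
    fix e :: real assume e: "0 < e"
    obtain n where n: "max 1 k / e < of_nat n * d"
      using reals_Archimedean3[OF assms(4)] by blast
    have "\<bar>?f 0 n x - ?f 0 n y\<bar> < e" if "x \<in> K" "y \<in> K" for x y
    proof -
      have "\<bar>?f 0 n x - ?f 0 n y\<bar> \<le> max 1 k / (max 1 k + of_nat n * d)"
        using near[OF that(1), of 0 n] near[OF that(2), of 0 n] assms(3,4)
        by (intro near_diff[of k "p 0"] K(1)[THEN subsetD] f_in that) auto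
      also have "\<dots> < e"
      proof -
        have "max 1 k < e * (of_nat n * d)" using n e by (simp add: field_simps)
        moreover have "0 < e * max 1 k" using e by simp
        ultimately have "max 1 k < e * (max 1 k + of_nat n * d)" by (simp add: distrib_left)
        moreover have "0 < max 1 k + of_nat n * d" using assms(4) by (simp add: add_pos_nonneg)
        ultimately show ?thesis by (simp add: pos_divide_less_eq)
      qed
      finally show ?thesis .
    qed
    then show "\<exists>n. \<forall>x\<in>K. \<forall>y\<in>K. \<bar>?f 0 n x - ?f 0 n y\<bar> < e" by blast
  qed
qed

text \<open>Either contracting pairs occur infinitely often along a sequence, or from some point on the
  sequence advances towards one fixed axis.\<close>

lemma word_cauchy_if_contracting_or_advancing:
  assumes fin: "finite S" and adm: "\<And>A. A \<in> S \<Longrightarrow> admissible A"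
    and K: "K \<subseteq> {0..1}" "\<And>A x. A \<in> S \<Longrightarrow> x \<in> K \<Longrightarrow> act A x \<in> K" and "0 < k" "t \<in> K"
    and pairs: "\<And>A B. A \<in> S \<Longrightarrow> B \<in> S \<Longrightarrow>
      \<exists>d>0. contracting K (1 - d) A B \<or> p A = q B \<and> advancing K k d (p A) (q A) A"
  shows "word_cauchy S t"
proof -
  define P where "P = (\<lambda>(A, B) d. contracting K (1 - d) A B \<or> p A = q B \<and> advancing K k d (p A) (q A) A)"
  \<comment> \<open>Both alternatives persist when \<open>d\<close> decreases, so one
    \<open>d\<close> serves all pairs; \<open>d < 1\<close> keeps the factor \<open>1 - d\<close>
    nonnegative.\<close>
  have "\<exists>d>0. d < 1 \<and> (\<forall>z\<in>S \<times> S. P z d)"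
  proof (rule finite_uniform_parameter)
    show "finite (S \<times> S)" using fin by simp
  next
    fix z d d' assume z: "z \<in> S \<times> S" "P z d" "0 < d'" "d' \<le> (d::real)"
    obtain A B where AB: "z = (A, B)" "A \<in> S" "B \<in> S" using z(1) by blast
    have "contracting K (1 - d') A B" if c: "contracting K (1 - d) A B"
      unfolding contracting_def
    proof (intro ballI)
      fix x y assume xy: "x \<in> K" "y \<in> K"
      have "gap (act A (act B x)) (act A (act B y)) \<le> (1 - d) * gap x y"
        using c xy unfolding contracting_def by blast
      also have "\<dots> \<le> (1 - d') * gap x y"
        using z(4) by (intro mult_right_mono gap_bounds K(1)[THEN subsetD] xy) simp
      finally show "gap (act A (act B x)) (act A (act B y)) \<le> (1 - d') * gap x y" .
    qed
    moreover have "advancing K k d' (p A) (q A) A" if "advancing K k d (p A) (q A) A"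
      unfolding advancing_def
    proof (intro allI impI ballI)
      fix x t assume xt: "0 \<le> x" "t \<in> K" "near k (p A) x t"
      have "near k (q A) (x + d) (act A t)" using that xt unfolding advancing_def by blast
      then show "near k (q A) (x + d') (act A t)"
        by (rule near_antimono[of k "q A" "x + d"]) (use z(4) K(1)[THEN subsetD, OF K(2)] AB xt in auto)
    qed
    ultimately show "P z d'" using z(2) by (auto simp: P_def AB)
  next
    fix z assume "z \<in> S \<times> S"
    then show "\<exists>d>0. P z d" using pairs by (auto simp: P_def)
  qed
  then obtain d where d: "0 < d" "d < 1" "\<And>A B. A \<in> S \<Longrightarrow> B \<in> S \<Longrightarrow> P (A, B) d" by blast
  show ?thesis
  proof (rule word_cauchyI[OF fin K(2) assms(6)])
    fix \<omega> :: "nat \<Rightarrow> real^2^2" assume \<omega>: "\<And>n. \<omega> n \<in> S"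
    show "shrinking K \<omega>"
    proof (cases "\<exists>\<^sub>\<infinity>n. contracting K (1 - d) (\<omega> n) (\<omega> (Suc n))")
      case True
      then show ?thesis using d(1,2) K adm \<omega> by (intro shrinking_if_contracting[where l = "1 - d"]) auto
    next
      case False
      then obtain m where m: "\<And>n. m \<le> n \<Longrightarrow> \<not> contracting K (1 - d) (\<omega> n) (\<omega> (Suc n))"
        unfolding INFM_nat_le by blast
      have "shrinking K (\<lambda>n. \<omega> (n + m))"
      \<comment> \<open>From \<open>m\<close> on \<open>p A = q B\<close> holds for neighbours
        \<open>A\<close>, \<open>B\<close>: each matrix receives from the axis towards which its
        right neighbour pushes.\<close>
      proof (rule shrinking_if_advancing[where k = k and d = d and p = "\<lambda>n. q (\<omega> (n + m))"])
        show "advancing K k d (q (\<omega> (Suc n + m))) (q (\<omega> (n + m))) (\<omega> (n + m))" for n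
          using d(3)[OF \<omega> \<omega>, of "n + m" "Suc (n + m)"] m[of "n + m"] by (auto simp: P_def)
      qed (use K \<omega> assms(5) d in auto)
      then show ?thesis by (rule shrinking_shift[of \<omega> K m, rotated 3]) (use K adm \<omega> in auto)
    qed
  qed
qed

subsection \<open>Sufficiency\<close>

lemma all_upper_iff:
  "(\<forall>a b d. mat2 a b 0 d \<in> S \<longrightarrow> Q a b d) \<longleftrightarrow> (\<forall>A\<in>S. A$2$1 = 0 \<longrightarrow> Q (A$1$1) (A$1$2) (A$2$2))"
  by (metis mat2_eta mat2_nth)

lemma all_lower_iff:
  "(\<forall>a c d. mat2 a 0 c d \<in> S \<longrightarrow> Q a c d) \<longleftrightarrow> (\<forall>A\<in>S. A$1$2 = 0 \<longrightarrow> Q (A$1$1) (A$2$1) (A$2$2))"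
  by (metis mat2_eta mat2_nth)

lemma all_zero22_iff:
  "(\<forall>a b c. mat2 a b c 0 \<in> S \<longrightarrow> Q a b c) \<longleftrightarrow> (\<forall>A\<in>S. A$2$2 = 0 \<longrightarrow> Q (A$1$1) (A$1$2) (A$2$1))"
  by (metis mat2_eta mat2_nth)

lemma all_zero11_iff:
  "(\<forall>b c d. mat2 0 b c d \<in> S \<longrightarrow> Q b c d) \<longleftrightarrow> (\<forall>A\<in>S. A$1$1 = 0 \<longrightarrow> Q (A$1$2) (A$2$1) (A$2$2))"
  by (metis mat2_eta mat2_nth)

lemma all_diagonal_iff:
  "(\<forall>a d. mat2 a 0 0 d \<notin> S) \<longleftrightarrow> (\<forall>A\<in>S. \<not> (A$1$2 = 0 \<and> A$2$1 = 0))"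
  by (metis mat2_eta mat2_nth)

lemma all_antidiagonal_iff:
  "(\<forall>b c. mat2 0 b c 0 \<notin> S) \<longleftrightarrow> (\<forall>A\<in>S. \<not> (A$1$1 = 0 \<and> A$2$2 = 0))"
  by (metis mat2_eta mat2_nth)

lemma all_zero22_zero11_iff:
  "(\<forall>a b c b' c' d'. mat2 a b c 0 \<in> S \<and> mat2 0 b' c' d' \<in> S \<longrightarrow> Q b c b' c') \<longleftrightarrow>
   (\<forall>A\<in>S. \<forall>B\<in>S. A$2$2 = 0 \<longrightarrow> B$1$1 = 0 \<longrightarrow> Q (A$1$2) (A$2$1) (B$1$2) (B$2$1))"
proof -
  have "(\<forall>a b c b' c' d'. mat2 a b c 0 \<in> S \<and> mat2 0 b' c' d' \<in> S \<longrightarrow> Q b c b' c') \<longleftrightarrow>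
    (\<forall>a b c. mat2 a b c 0 \<in> S \<longrightarrow> (\<forall>b' c' d'. mat2 0 b' c' d' \<in> S \<longrightarrow> Q b c b' c'))" by blast
  also have "\<dots> \<longleftrightarrow> (\<forall>A\<in>S. A$2$2 = 0 \<longrightarrow>
      (\<forall>b' c' d'. mat2 0 b' c' d' \<in> S \<longrightarrow> Q (A$1$2) (A$2$1) b' c'))"
    by (rule all_zero22_iff)
  also have "\<dots> \<longleftrightarrow> (\<forall>A\<in>S. A$2$2 = 0 \<longrightarrow>
      (\<forall>B\<in>S. B$1$1 = 0 \<longrightarrow> Q (A$1$2) (A$2$1) (B$1$2) (B$2$1)))"
    unfolding all_zero11_iff ..
  finally show ?thesis by blast
qed

lemma case1_iff: "case1 S \<longleftrightarrow>
    (\<forall>A\<in>S. A$2$1 = 0 \<longrightarrow> A$2$2 \<le> A$1$1) \<and> (\<forall>A\<in>S. A$1$2 = 0 \<longrightarrow> A$1$1 \<le> A$2$2) \<and>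
    (\<forall>A\<in>S. \<forall>B\<in>S. A$2$2 = 0 \<longrightarrow> B$1$1 = 0 \<longrightarrow> B$1$2 * A$2$1 \<le> A$1$2 * B$2$1) \<and>
    (\<forall>A\<in>S. \<not> (A$1$2 = 0 \<and> A$2$1 = 0)) \<and> (\<forall>A\<in>S. \<not> (A$1$1 = 0 \<and> A$2$2 = 0))"
  unfolding case1_def all_upper_iff all_lower_iff all_zero22_zero11_iff all_diagonal_iff
    all_antidiagonal_iff ..

lemma case2_iff: "case2 S \<longleftrightarrow>
    (\<forall>A\<in>S. A$2$1 = 0 \<longrightarrow> A$1$1 < A$2$2) \<and> (\<forall>A\<in>S. A$1$2 = 0 \<longrightarrow> A$2$2 < A$1$1) \<and>
    (\<forall>A\<in>S. \<forall>B\<in>S. A$2$2 = 0 \<longrightarrow> B$1$1 = 0 \<longrightarrow> A$1$2 * B$2$1 < B$1$2 * A$2$1)"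
  unfolding case2_def all_upper_iff all_lower_iff all_zero22_zero11_iff ..

lemma case3_iff: "case3 S \<longleftrightarrow>
    (\<forall>A\<in>S. A$2$1 = 0 \<longrightarrow> A$2$2 \<le> A$1$1) \<and> (\<forall>A\<in>S. A$1$2 = 0 \<longrightarrow> A$2$2 < A$1$1) \<and>
    (\<forall>A\<in>S. A$1$1 \<noteq> 0)"
  unfolding case3_def all_upper_iff all_lower_iff all_zero11_iff[where Q = "\<lambda>_ _ _. False", simplified] ..

lemma case4_iff: "case4 S \<longleftrightarrow>
    (\<forall>A\<in>S. A$2$1 = 0 \<longrightarrow> A$1$1 < A$2$2) \<and> (\<forall>A\<in>S. A$1$2 = 0 \<longrightarrow> A$1$1 \<le> A$2$2) \<and>
    (\<forall>A\<in>S. A$2$2 \<noteq> 0)"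
  unfolding case4_def all_upper_iff all_lower_iff all_zero22_iff[where Q = "\<lambda>_ _ _. False", simplified] ..

section \<open>Matrices that advance towards an axis\<close>

lemma near_act_iff:
  assumes "admissible A" "t \<in> {0..1}"
  shows "near k p x (act A t) \<longleftrightarrow>
    (if p then x * (A$2$1 * t + A$2$2 * (1 - t)) \<le> A$1$1 * t + A$1$2 * (1 - t)
     else x * (A$1$1 * t + A$1$2 * (1 - t)) \<le> k * (A$2$1 * t + A$2$2 * (1 - t)))"
  using mass_pos[OF assms]
  unfolding near_def one_minus_act[OF assms] unfolding act_def by (simp add: divide_le_cancel)

lemma advancingI:
  assumes "admissible A" "K \<subseteq> {0..1}"
    and "\<And>x t. 0 \<le> x \<Longrightarrow> t \<in> K \<Longrightarrow> 0 \<le> t \<Longrightarrow> 0 \<le> 1 - t \<Longrightarrow> near k p x t \<Longrightarrow>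
      if q then (x + d) * (A$2$1 * t + A$2$2 * (1 - t)) \<le> A$1$1 * t + A$1$2 * (1 - t)
      else (x + d) * (A$1$1 * t + A$1$2 * (1 - t)) \<le> k * (A$2$1 * t + A$2$2 * (1 - t))"
  shows "advancing K k d p q A"
  unfolding advancing_def
proof (intro allI impI ballI)
  fix x t assume x: "0 \<le> x" "t \<in> K" "near k p x t"
  then have t: "t \<in> {0..1}" using assms(2) by blast
  show "near k q (x + d) (act A t)"
    unfolding near_act_iff[OF assms(1) t] by (rule assms(3)) (use x t in auto)
qed

text \<open>The action \<open>(A$1$1 * r + A$1$2) / A$2$2\<close> gains at least
  \<open>A$1$2 / A$2$2\<close>; the \<open>1\<close> in the denominator of \<open>d\<close> covers
  \<open>A$2$2 = 0\<close>.\<close>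

lemma ex_advancing_upper:
  assumes adm: "admissible A" and K: "K \<subseteq> {0..1}" and A: "A$2$1 = 0" "A$2$2 \<le> A$1$1" "0 < A$1$2"
  shows "\<exists>d>0. advancing K k d True True A"
proof -
  have A': "0 \<le> A$2$2" using adm by (simp add: admissible_iff)
  define d where "d = A$1$2 / (A$2$2 + 1)"
  have d: "0 < d" "d * A$2$2 \<le> A$1$2" using A A' by (auto simp: d_def field_simps)
  have "advancing K k d True True A"
  proof (rule advancingI[OF adm K])
    fix x t assume t: "0 \<le> x" "t \<in> K" "0 \<le> t" "0 \<le> 1 - t" "near k True x t"
    have "A$2$2 * (x * (1 - t)) \<le> A$2$2 * t" using t A' by (intro mult_left_mono) (auto simp: near_def)
    moreover have "A$2$2 * t \<le> A$1$1 * t" using t A by (intro mult_right_mono) auto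
    moreover have "d * A$2$2 * (1 - t) \<le> A$1$2 * (1 - t)" using t d by (intro mult_right_mono) auto
    ultimately show "if True then (x + d) * (A$2$1 * t + A$2$2 * (1 - t)) \<le> A$1$1 * t + A$1$2 * (1 - t)
      else (x + d) * (A$1$1 * t + A$1$2 * (1 - t)) \<le> k * (A$2$1 * t + A$2$2 * (1 - t))"
      using A(1) by (simp add: algebra_simps)
  qed
  then show ?thesis using d by blast
qed

text \<open>Here the gain comes from the ratio \<open>A$1$1 / A$2$2\<close> and is proportional to
  \<open>r\<close>, so it is bounded below only away from the second axis; hence
  \<open>\<eta>\<close>.\<close>

lemma ex_advancing_upper_away:
  assumes adm: "admissible A" and K: "0 < \<eta>" "K \<subseteq> {\<eta>..1}" and A: "A$2$1 = 0" "A$2$2 < A$1$1"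
  shows "\<exists>d>0. advancing K k d True True A"
proof -
  have A': "0 \<le> A$2$2" "0 \<le> A$1$2" using adm by (simp_all add: admissible_iff)
  define d where "d = (A$1$1 - A$2$2) * \<eta> / (A$2$2 + 1)"
  have d0: "0 < d" using A A' K by (simp add: d_def)
  have "d * (A$2$2 + 1) = (A$1$1 - A$2$2) * \<eta>" using A' by (simp add: d_def)
  then have d: "d * A$2$2 \<le> (A$1$1 - A$2$2) * \<eta>" using d0 by (simp add: algebra_simps)
  have K': "K \<subseteq> {0..1}" using K by force
  have "advancing K k d True True A"
  proof (rule advancingI[OF adm K'])
    fix x t assume t: "0 \<le> x" "t \<in> K" "0 \<le> t" "0 \<le> 1 - t" "near k True x t"
    have "\<eta> \<le> t" using t K by auto
    have "A$2$2 * (x * (1 - t)) \<le> A$2$2 * t" using t A' by (intro mult_left_mono) (auto simp: near_def)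
    moreover have "d * A$2$2 * (1 - t) \<le> d * A$2$2 * 1"
      using t d0 A' by (intro mult_left_mono) auto
    moreover have "(A$1$1 - A$2$2) * \<eta> \<le> (A$1$1 - A$2$2) * t"
      using \<open>\<eta> \<le> t\<close> A by (intro mult_left_mono) auto
    moreover have "0 \<le> A$1$2 * (1 - t)" using t A' by simp
    ultimately show "if True then (x + d) * (A$2$1 * t + A$2$2 * (1 - t)) \<le> A$1$1 * t + A$1$2 * (1 - t)
      else (x + d) * (A$1$1 * t + A$1$2 * (1 - t)) \<le> k * (A$2$1 * t + A$2$2 * (1 - t))"
      using A(1) d by (simp add: algebra_simps)
  qed
  then show ?thesis using d0 by blast
qed

text \<open>The coordinate \<open>k / r\<close> is multiplied by \<open>A$2$2 / A$1$1\<close> and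
  increased by \<open>k * A$2$1 / A$1$1\<close>.\<close>

lemma ex_advancing_lower:
  assumes adm: "admissible A" and K: "K \<subseteq> {0..1}" and "0 < k"
    and A: "A$1$2 = 0" "A$1$1 \<le> A$2$2" "0 < A$2$1"
  shows "\<exists>d>0. advancing K k d False False A"
proof -
  have A': "0 \<le> A$1$1" using adm by (simp add: admissible_iff)
  define d where "d = k * A$2$1 / (A$1$1 + 1)"
  have d0: "0 < d" using A A' assms(3) by (simp add: d_def)
  have "d * (A$1$1 + 1) = k * A$2$1" using A' by (simp add: d_def)
  then have d: "d * A$1$1 \<le> k * A$2$1" using d0 by (simp add: algebra_simps)
  have "advancing K k d False False A"
  proof (rule advancingI[OF adm K])
    fix x t assume t: "0 \<le> x" "t \<in> K" "0 \<le> t" "0 \<le> 1 - t" "near k False x t"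
    have "A$1$1 * (x * t) \<le> A$1$1 * (k * (1 - t))" using t A' by (intro mult_left_mono) (auto simp: near_def)
    moreover have "A$1$1 * (k * (1 - t)) \<le> A$2$2 * (k * (1 - t))"
      using t A assms(3) by (intro mult_right_mono) auto
    moreover have "d * A$1$1 * t \<le> k * A$2$1 * t" using t d by (intro mult_right_mono) auto
    ultimately show "if False then (x + d) * (A$2$1 * t + A$2$2 * (1 - t)) \<le> A$1$1 * t + A$1$2 * (1 - t)
      else (x + d) * (A$1$1 * t + A$1$2 * (1 - t)) \<le> k * (A$2$1 * t + A$2$2 * (1 - t))"
      using A(1) by (simp add: algebra_simps)
  qed
  then show ?thesis using d0 by blast
qed

text \<open>Since \<open>r\<close> goes to \<open>A$1$1 / A$2$1 + (A$1$2 / A$2$1) / r\<close> and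
  \<open>1 / r\<close> is at least \<open>x / k\<close>, the bound on \<open>k\<close> gives
  \<open>x\<close> a coefficient of at least \<open>1\<close>; the first summand is the
  gain.\<close>

lemma ex_advancing_zero22:
  assumes adm: "admissible A" and K: "K \<subseteq> {0..1}"
    and A: "A$2$2 = 0" "0 < A$1$1" "0 < A$2$1" "k * A$2$1 \<le> A$1$2"
  shows "\<exists>d>0. advancing K k d False True A"
proof -
  define d where "d = A$1$1 / A$2$1"
  have d: "0 < d" "d * A$2$1 = A$1$1" using A by (simp_all add: d_def)
  have "advancing K k d False True A"
  proof (rule advancingI[OF adm K])
    fix x t assume t: "0 \<le> x" "t \<in> K" "0 \<le> t" "0 \<le> 1 - t" "near k False x t"
    have "A$2$1 * (x * t) \<le> A$2$1 * (k * (1 - t))" using t A by (intro mult_left_mono) (auto simp: near_def)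
    moreover have "k * A$2$1 * (1 - t) \<le> A$1$2 * (1 - t)" using t A by (intro mult_right_mono) auto
    moreover have "d * A$2$1 * t \<le> A$1$1 * t" by (simp only: d)
    ultimately show "if True then (x + d) * (A$2$1 * t + A$2$2 * (1 - t)) \<le> A$1$1 * t + A$1$2 * (1 - t)
      else (x + d) * (A$1$1 * t + A$1$2 * (1 - t)) \<le> k * (A$2$1 * t + A$2$2 * (1 - t))"
      using A(1) by (simp add: algebra_simps)
  qed
  then show ?thesis using d by blast
qed

text \<open>The coordinate \<open>k / r\<close> of the image is
  \<open>k * (A$2$1 * r + A$2$2) / A$1$2\<close>: the coefficient of \<open>r\<close> is at least
  \<open>1\<close> by the bound on \<open>k\<close>, and the constant term is the gain.\<close>

lemma ex_advancing_zero11: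
  assumes adm: "admissible A" and K: "K \<subseteq> {0..1}" and "0 < k"
    and A: "A$1$1 = 0" "0 < A$1$2" "0 < A$2$2" "A$1$2 \<le> k * A$2$1"
  shows "\<exists>d>0. advancing K k d True False A"
proof -
  define d where "d = k * A$2$2 / A$1$2"
  have d: "0 < d" "d * A$1$2 = k * A$2$2" using A assms(3) by (simp_all add: d_def)
  have "advancing K k d True False A"
  proof (rule advancingI[OF adm K])
    fix x t assume t: "0 \<le> x" "t \<in> K" "0 \<le> t" "0 \<le> 1 - t" "near k True x t"
    have "A$1$2 * (x * (1 - t)) \<le> A$1$2 * t" using t A by (intro mult_left_mono) (auto simp: near_def)
    moreover have "A$1$2 * t \<le> k * A$2$1 * t" using t A by (intro mult_right_mono) auto
    moreover have "d * A$1$2 * (1 - t) = k * A$2$2 * (1 - t)" using d by simp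
    ultimately show "if False then (x + d) * (A$2$1 * t + A$2$2 * (1 - t)) \<le> A$1$1 * t + A$1$2 * (1 - t)
      else (x + d) * (A$1$1 * t + A$1$2 * (1 - t)) \<le> k * (A$2$1 * t + A$2$2 * (1 - t))"
      using A(1) by (simp add: algebra_simps)
  qed
  then show ?thesis using d by blast
qed

lemma convex_combination_ge_Min:
  fixes a b t :: real
  assumes "t \<in> {0..1}"
  shows "min a b \<le> a * t + b * (1 - t)"
proof -
  have "min a b * t \<le> a * t" "min a b * (1 - t) \<le> b * (1 - t)"
    using assms by (auto intro: mult_right_mono)
  then show ?thesis by (simp add: algebra_simps)
qed

lemma mass_le:
  assumes "admissible A" "t \<in> {0..1}"
  shows "mass A t \<le> A$1$1 + A$2$1 + A$1$2 + A$2$2"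
proof -
  have "(A$1$1 + A$2$1) * t \<le> (A$1$1 + A$2$1) * 1" "(A$1$2 + A$2$2) * (1 - t) \<le> (A$1$2 + A$2$2) * 1"
    using assms by (intro mult_left_mono; simp add: admissible_iff)+
  then show ?thesis by (simp add: mass_def)
qed

lemma act_bounded_below:
  assumes "admissible A" "0 < A$1$1" "0 < A$1$2"
  obtains \<eta> where "0 < \<eta>" "\<And>t. t \<in> {0..1} \<Longrightarrow> \<eta> \<le> act A t"
proof (rule that[of "min (A$1$1) (A$1$2) / (A$1$1 + A$2$1 + A$1$2 + A$2$2)"])
  show "0 < min (A$1$1) (A$1$2) / (A$1$1 + A$2$1 + A$1$2 + A$2$2)"
    using assms by (auto simp: admissible_iff intro!: divide_pos_pos add_pos_nonneg)
  fix t :: real assume t: "t \<in> {0..1}"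
  show "min (A$1$1) (A$1$2) / (A$1$1 + A$2$1 + A$1$2 + A$2$2) \<le> act A t"
    unfolding act_def using assms convex_combination_ge_Min[OF t] mass_le[OF assms(1) t] mass_pos[OF assms(1) t] t
    by (intro frac_le) (auto simp: less_imp_le)
qed

lemma act_bounded_above:
  assumes "admissible A" "0 < A$2$1" "0 < A$2$2"
  obtains \<eta> where "0 < \<eta>" "\<And>t. t \<in> {0..1} \<Longrightarrow> \<eta> \<le> 1 - act A t"
proof (rule that[of "min (A$2$1) (A$2$2) / (A$1$1 + A$2$1 + A$1$2 + A$2$2)"])
  show "0 < min (A$2$1) (A$2$2) / (A$1$1 + A$2$1 + A$1$2 + A$2$2)"
    using assms by (auto simp: admissible_iff intro!: divide_pos_pos add_pos_nonneg add_nonneg_pos)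
  fix t :: real assume t: "t \<in> {0..1}"
  show "min (A$2$1) (A$2$2) / (A$1$1 + A$2$1 + A$1$2 + A$2$2) \<le> 1 - act A t"
    unfolding one_minus_act[OF assms(1) t] using assms convex_combination_ge_Min[OF t] mass_le[OF assms(1) t] mass_pos[OF assms(1) t] t
    by (intro frac_le) (auto simp: less_imp_le)
qed

lemma word_cauchy_case1:
  assumes fin: "finite S" and adm: "\<And>A. A \<in> S \<Longrightarrow> admissible A" and t: "t \<in> {0..1}" and "case1 S"
  shows "word_cauchy S t"
proof -
  have upper: "A$2$2 \<le> A$1$1" if "A \<in> S" "A$2$1 = 0" for A
    using assms(4) that unfolding case1_iff by blast
  have lower: "A$1$1 \<le> A$2$2" if "A \<in> S" "A$1$2 = 0" for A
    using assms(4) that unfolding case1_iff by blast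
  have pair: "B$1$2 * A$2$1 \<le> A$1$2 * B$2$1" if "A \<in> S" "B \<in> S" "A$2$2 = 0" "B$1$1 = 0" for A B
    using assms(4) that unfolding case1_iff by blast
  have diag: "A$1$2 \<noteq> 0 \<or> A$2$1 \<noteq> 0" if "A \<in> S" for A
    using assms(4) that unfolding case1_iff by blast
  have anti: "A$1$1 \<noteq> 0 \<or> A$2$2 \<noteq> 0" if "A \<in> S" for A
    using assms(4) that unfolding case1_iff by blast
  have ge0: "0 \<le> A$1$1" "0 \<le> A$1$2" "0 \<le> A$2$1" "0 \<le> A$2$2" "0 < A$1$1 + A$2$1" "0 < A$1$2 + A$2$2"
    if "A \<in> S" for A using adm[OF that] by (auto simp: admissible_iff)
  define X where "X = {B \<in> S. B$1$1 = 0}"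
  \<comment> \<open>Matrices with \<open>A$2$1 = 0\<close> are left out because their ratio would be
    infinite; for them \<open>kY\<close> below is immediate.\<close>
  define Y where "Y = {A \<in> S. A$2$2 = 0 \<and> A$2$1 \<noteq> 0}"
  obtain k where k: "0 < k" "\<And>x. x \<in> (\<lambda>B. B$1$2 / B$2$1) ` X \<Longrightarrow> x \<le> k"
    "\<And>y. y \<in> (\<lambda>A. A$1$2 / A$2$1) ` Y \<Longrightarrow> k \<le> y"
  proof (rule separate_finite_sets)
    show "finite ((\<lambda>B. B$1$2 / B$2$1) ` X)" "finite ((\<lambda>A. A$1$2 / A$2$1) ` Y)"
      using fin by (auto simp: X_def Y_def)
  next
    fix y assume "y \<in> (\<lambda>A. A$1$2 / A$2$1) ` Y"
    then show "0 < y" using ge0 by (force simp: Y_def)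
  next
    fix x y assume "x \<in> (\<lambda>B. B$1$2 / B$2$1) ` X" "y \<in> (\<lambda>A. A$1$2 / A$2$1) ` Y"
    then obtain A B where AB: "A \<in> Y" "B \<in> X" "x = B$1$2 / B$2$1" "y = A$1$2 / A$2$1" by blast
    then have "0 < A$2$1" "0 < B$2$1" using ge0[of A] ge0[of B] by (auto simp: X_def Y_def)
    then show "x \<le> y" using AB(1,2) pair[of A B] unfolding AB(3,4) by (auto simp: X_def Y_def field_simps)
  qed blast
  have kX: "B$1$2 \<le> k * B$2$1" if "B \<in> S" "B$1$1 = 0" for B
    using k(2)[of "B$1$2 / B$2$1"] ge0[OF that(1)] that by (auto simp: X_def field_simps)
  have kY: "k * A$2$1 \<le> A$1$2" if "A \<in> S" "A$2$2 = 0" for A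
  proof (cases "A$2$1 = 0")
    case False
    then show ?thesis using k(3)[of "A$1$2 / A$2$1"] ge0[OF that(1)] that by (auto simp: Y_def field_simps)
  qed (use ge0[OF that(1)] in simp)
  txt \<open>\<open>p A\<close> is the axis from which \<open>A\<close> is expected to receive, \<open>q A\<close> the one towards which it pushes;
    a mismatch \<open>p A \<noteq> q B\<close> makes the product of \<open>A\<close> and \<open>B\<close> positive or singular.\<close>
  define p q where "p A \<longleftrightarrow> A$1$1 * A$2$1 = 0 \<and> A$1$2 \<noteq> 0" and "q A \<longleftrightarrow> A$2$1 * A$2$2 = 0"
    for A :: "real^2^2"
  have advance: "\<exists>d>0. advancing {0..1} k d (p A) (q A) A"
    \<comment> \<open>The four positions of a zero entry yield the four advancing types;
      \<open>diag\<close> or \<open>anti\<close> makes the gain positive.\<close>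
    if A: "A \<in> S" and npos: "\<not> (0 < A$1$1 \<and> 0 < A$1$2 \<and> 0 < A$2$1 \<and> 0 < A$2$2)" for A
  proof -
    have "A$1$1 = 0 \<or> A$1$2 = 0 \<or> A$2$1 = 0 \<or> A$2$2 = 0"
      using npos ge0[OF A] by (auto simp: less_le)
    then consider "A$2$1 = 0" | "A$1$2 = 0" | "A$2$2 = 0" "A$2$1 \<noteq> 0" | "A$1$1 = 0" "A$1$2 \<noteq> 0"
      by blast
    then show ?thesis
    proof cases
      case 1
      then have "p A" "q A" "0 < A$1$2" using diag[OF A] ge0[OF A] by (auto simp: p_def q_def)
      then show ?thesis using ex_advancing_upper[OF adm[OF A] order_refl 1 upper[OF A 1]] by simp
    next
      case 2
      then have "\<not> p A" "\<not> q A" "0 < A$2$1" using diag[OF A] ge0[OF A] by (auto simp: p_def q_def)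
      then show ?thesis using ex_advancing_lower[OF adm[OF A] order_refl k(1) 2 lower[OF A 2]] by simp
    next
      case 3
      then have "\<not> p A" "q A" "0 < A$1$1" "0 < A$2$1" using anti[OF A] ge0[OF A] by (auto simp: p_def q_def)
      then show ?thesis using ex_advancing_zero22[OF adm[OF A] order_refl 3(1) _ _ kY[OF A 3(1)]] by simp
    next
      case 4
      then have "p A" "\<not> q A" "0 < A$1$2" "0 < A$2$2" using anti[OF A] ge0[OF A] by (auto simp: p_def q_def)
      then show ?thesis using ex_advancing_zero11[OF adm[OF A] order_refl k(1) 4(1) _ _ kX[OF A 4(1)]] by simp
    qed
  qed
  show ?thesis
  proof (rule word_cauchy_if_contracting_or_advancing[OF fin adm order_refl _ k(1) t, where p = p and q = q])
    fix A x assume "A \<in> S" "x \<in> {0..1::real}"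
    then show "act A x \<in> {0..1}" using act_in_unit adm by blast
  next
    fix A B assume AB: "A \<in> S" "B \<in> S"
    note AB' = adm[OF AB(1)] adm[OF AB(2)] order_refl[of "{0..1::real}"]
    consider "0 < A$1$1 \<and> 0 < A$1$2 \<and> 0 < A$2$1 \<and> 0 < A$2$2"
      | "\<not> (0 < A$1$1 \<and> 0 < A$1$2 \<and> 0 < A$2$1 \<and> 0 < A$2$2)" "p A = q B"
      | "p A" "\<not> q B" | "\<not> p A" "q B" by blast
    then show "\<exists>d>0. contracting {0..1} (1 - d) A B \<or> p A = q B \<and> advancing {0..1} k d (p A) (q A) A"
    proof cases
      case 1
      then show ?thesis using ex_contracting_positive[OF AB'] by blast
    next
      case 2
      then show ?thesis using advance[OF AB(1)] by blast
    next
      case 3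
      then have "0 < B$2$1" "0 < B$2$2" using ge0[OF AB(2)] by (auto simp: q_def)
      then obtain \<eta> where \<eta>: "0 < \<eta>" "\<And>t. t \<in> {0..1} \<Longrightarrow> \<eta> \<le> 1 - act B t"
        using act_bounded_above adm[OF AB(2)] by blast
      \<comment> \<open>If \<open>A$2$2 = 0\<close>, then \<open>p A\<close> and \<open>anti\<close>
        force \<open>A$2$1 = 0\<close>, so \<open>A\<close> is singular.\<close>
      have "A$1$1 * A$2$2 = A$1$2 * A$2$1 \<or> 0 < A$1$2 * A$2$2"
        using 3(1) ge0[OF AB(1)] anti[OF AB(1)] by (cases "A$2$2 = 0") (auto simp: p_def)
      then show ?thesis using ex_contracting_row2[OF AB' \<eta>] by blast
    next
      case 4
      then have "0 < B$1$1" "0 < B$1$2"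
        using ge0[OF AB(2)] anti[OF AB(2)] diag[OF AB(2)] by (auto simp: q_def)
      then obtain \<eta> where \<eta>: "0 < \<eta>" "\<And>t. t \<in> {0..1} \<Longrightarrow> \<eta> \<le> act B t"
        using act_bounded_below adm[OF AB(2)] by blast
      \<comment> \<open>If \<open>A$1$1 = 0\<close>, then the negation of \<open>p A\<close> forces
        \<open>A$1$2 = 0\<close>, so \<open>A\<close> is singular.\<close>
      have "A$1$1 * A$2$2 = A$1$2 * A$2$1 \<or> 0 < A$1$1 * A$2$1"
        using 4(1) ge0[OF AB(1)] diag[OF AB(1)] by (cases "A$1$1 = 0") (auto simp: p_def)
      then show ?thesis using ex_contracting_row1[OF AB' \<eta>] by blast
    qed
  qed
qed

section \<open>Intervals bounded away from the axes that the matrices preserve\<close>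

lemma near_True_invariant:
  assumes adm: "admissible A" and A: "0 < A$1$1 \<and> 0 < A$1$2 \<or> A$1$2 = 0 \<and> A$2$2 < A$1$1"
  shows "\<exists>d>0. \<forall>e. 0 < e \<and> e \<le> d \<longrightarrow> (\<forall>s\<in>{0..1}. near k True e s \<longrightarrow> near k True e (act A s))"
proof -
  have ge0: "0 \<le> A$2$1" "0 \<le> A$2$2" using adm by (auto simp: admissible_iff)
  show ?thesis using A
  proof
    assume A: "0 < A$1$1 \<and> 0 < A$1$2"
    \<comment> \<open>A positive first row sends \<open>r\<close> to at least the smaller of the
      column ratios \<open>A$1$1 / A$2$1\<close> and \<open>A$1$2 / A$2$2\<close>.\<close>
    define d where "d = min (A$1$1 / (A$2$1 + 1)) (A$1$2 / (A$2$2 + 1))"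
    have d: "0 < d" using A ge0 by (simp add: d_def add_nonneg_pos)
    have "near k True e (act A s)" if e: "0 < e" "e \<le> d" and s: "s \<in> {0..1}" for e s
    proof -
      have "e \<le> A$1$1 / (A$2$1 + 1)" "e \<le> A$1$2 / (A$2$2 + 1)" using e by (auto simp: d_def)
      then have "e * (A$2$1 + 1) \<le> A$1$1" "e * (A$2$2 + 1) \<le> A$1$2"
        using ge0 by (simp_all add: pos_le_divide_eq)
      then have le: "e * A$2$1 \<le> A$1$1" "e * A$2$2 \<le> A$1$2" using e by (simp_all add: algebra_simps)
      have "e * A$2$1 * s \<le> A$1$1 * s" "e * A$2$2 * (1 - s) \<le> A$1$2 * (1 - s)"
        using s le by (auto intro: mult_right_mono)
      then show ?thesis unfolding near_act_iff[OF adm s] by (simp add: algebra_simps)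
    qed
    then show ?thesis using d by blast
  next
    assume A: "A$1$2 = 0 \<and> A$2$2 < A$1$1"
    \<comment> \<open>The increasing map \<open>A$1$1 * r / (A$2$1 * r + A$2$2)\<close> has a value
      of at least \<open>e\<close> at \<open>r = e\<close> once
      \<open>e * A$2$1 \<le> A$1$1 - A$2$2\<close>: the second axis repels.\<close>
    define d where "d = (A$1$1 - A$2$2) / (A$2$1 + 1)"
    have d: "0 < d" using A ge0 by (simp add: d_def add_nonneg_pos)
    have "near k True e (act A s)" if e: "0 < e" "e \<le> d" and s: "s \<in> {0..1}" "near k True e s" for e s
    proof -
      have "e * (A$2$1 + 1) \<le> A$1$1 - A$2$2" using e ge0 by (simp add: d_def pos_le_divide_eq)
      then have le: "e * A$2$1 \<le> A$1$1 - A$2$2" using e by (simp add: algebra_simps)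
      have "e * A$2$1 * s \<le> (A$1$1 - A$2$2) * s" using s le by (intro mult_right_mono) auto
      moreover have "A$2$2 * (e * (1 - s)) \<le> A$2$2 * s"
        using s ge0 by (intro mult_left_mono) (auto simp: near_def)
      ultimately show ?thesis unfolding near_act_iff[OF adm s(1)] using A by (simp add: algebra_simps)
    qed
    then show ?thesis using d by blast
  qed
qed

text \<open>The action is nonincreasing in \<open>r\<close>, so the lower end of the image is
  governed by the upper end \<open>k / e\<close>. Its image is at least \<open>e\<close> when
  \<open>k * A$2$1 + e * A$2$2 \<le> A$1$2\<close>.\<close>

lemma near_True_invariant_zero11:
  assumes adm: "admissible A" and A: "A$1$1 = 0" "k * A$2$1 < A$1$2"
  shows "\<exists>d>0. \<forall>e. 0 < e \<and> e \<le> d \<longrightarrow> (\<forall>s\<in>{0..1}. near k False e s \<longrightarrow> near k True e (act A s))"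
proof -
  have ge0: "0 \<le> A$2$1" "0 \<le> A$2$2" using adm by (auto simp: admissible_iff)
  define d where "d = (A$1$2 - k * A$2$1) / (A$2$2 + 1)"
  have d: "0 < d" using A ge0 by (simp add: d_def add_nonneg_pos)
  have "near k True e (act A s)" if e: "0 < e" "e \<le> d" and s: "s \<in> {0..1}" "near k False e s" for e s
  proof -
    have "e * (A$2$2 + 1) \<le> A$1$2 - k * A$2$1" using e ge0 by (simp add: d_def pos_le_divide_eq)
    then have le: "e * A$2$2 \<le> A$1$2 - k * A$2$1" using e by (simp add: algebra_simps)
    have "e * A$2$2 * (1 - s) \<le> (A$1$2 - k * A$2$1) * (1 - s)" using s le by (intro mult_right_mono) auto
    moreover have "A$2$1 * (e * s) \<le> A$2$1 * (k * (1 - s))"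
      using s ge0 by (intro mult_left_mono) (auto simp: near_def)
    ultimately show ?thesis unfolding near_act_iff[OF adm s(1)] using A by (simp add: algebra_simps)
  qed
  then show ?thesis using d by blast
qed

lemma near_False_invariant:
  assumes adm: "admissible A" and k: "0 < k"
    and A: "0 < A$2$1 \<and> 0 < A$2$2 \<or> A$2$1 = 0 \<and> A$1$1 < A$2$2"
  shows "\<exists>d>0. \<forall>e. 0 < e \<and> e \<le> d \<longrightarrow> (\<forall>s\<in>{0..1}. near k False e s \<longrightarrow> near k False e (act A s))"
proof -
  have ge0: "0 \<le> A$1$1" "0 \<le> A$1$2" using adm by (auto simp: admissible_iff)
  show ?thesis using A
  proof
    assume A: "0 < A$2$1 \<and> 0 < A$2$2"
    define d where "d = min (k * A$2$1 / (A$1$1 + 1)) (k * A$2$2 / (A$1$2 + 1))"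
    have d: "0 < d" using A ge0 k by (simp add: d_def add_nonneg_pos)
    have "near k False e (act A s)" if e: "0 < e" "e \<le> d" and s: "s \<in> {0..1}" for e s
    proof -
      have "e \<le> k * A$2$1 / (A$1$1 + 1)" "e \<le> k * A$2$2 / (A$1$2 + 1)" using e by (auto simp: d_def)
      then have "e * (A$1$1 + 1) \<le> k * A$2$1" "e * (A$1$2 + 1) \<le> k * A$2$2"
        using ge0 by (simp_all add: pos_le_divide_eq)
      then have le: "e * A$1$1 \<le> k * A$2$1" "e * A$1$2 \<le> k * A$2$2" using e by (simp_all add: algebra_simps)
      have "e * A$1$1 * s \<le> k * A$2$1 * s" "e * A$1$2 * (1 - s) \<le> k * A$2$2 * (1 - s)"
        using s le by (auto intro: mult_right_mono)
      then show ?thesis unfolding near_act_iff[OF adm s] by (simp add: algebra_simps)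
    qed
    then show ?thesis using d by blast
  next
    assume A: "A$2$1 = 0 \<and> A$1$1 < A$2$2"
    define d where "d = k * (A$2$2 - A$1$1) / (A$1$2 + 1)"
    have d: "0 < d" using A ge0 k by (simp add: d_def add_nonneg_pos)
    have "near k False e (act A s)" if e: "0 < e" "e \<le> d" and s: "s \<in> {0..1}" "near k False e s" for e s
    proof -
      have "e * (A$1$2 + 1) \<le> k * (A$2$2 - A$1$1)" using e ge0 by (simp add: d_def pos_le_divide_eq)
      then have le: "e * A$1$2 \<le> k * (A$2$2 - A$1$1)" using e by (simp add: algebra_simps)
      have "e * A$1$2 * (1 - s) \<le> k * (A$2$2 - A$1$1) * (1 - s)" using s le by (intro mult_right_mono) auto
      moreover have "A$1$1 * (e * s) \<le> A$1$1 * (k * (1 - s))"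
        using s ge0 by (intro mult_left_mono) (auto simp: near_def)
      ultimately show ?thesis unfolding near_act_iff[OF adm s(1)] using A by (simp add: algebra_simps)
    qed
    then show ?thesis using d by blast
  qed
qed

text \<open>Likewise \<open>r\<close> at least \<open>e\<close> goes to at most \<open>k / e\<close>
  when \<open>A$1$2 + e * A$1$1 \<le> k * A$2$1\<close>.\<close>

lemma near_False_invariant_zero22:
  assumes adm: "admissible A" and A: "A$2$2 = 0" "A$1$2 < k * A$2$1"
  shows "\<exists>d>0. \<forall>e. 0 < e \<and> e \<le> d \<longrightarrow> (\<forall>s\<in>{0..1}. near k True e s \<longrightarrow> near k False e (act A s))"
proof -
  have ge0: "0 \<le> A$1$1" "0 \<le> A$1$2" using adm by (auto simp: admissible_iff)
  define d where "d = (k * A$2$1 - A$1$2) / (A$1$1 + 1)"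
  have d: "0 < d" using A ge0 by (simp add: d_def add_nonneg_pos)
  have "near k False e (act A s)" if e: "0 < e" "e \<le> d" and s: "s \<in> {0..1}" "near k True e s" for e s
  proof -
    have "e * (A$1$1 + 1) \<le> k * A$2$1 - A$1$2" using e ge0 by (simp add: d_def pos_le_divide_eq)
    then have le: "e * A$1$1 \<le> k * A$2$1 - A$1$2" using e by (simp add: algebra_simps)
    have "e * A$1$1 * s \<le> (k * A$2$1 - A$1$2) * s" using s le by (intro mult_right_mono) auto
    moreover have "A$1$2 * (e * (1 - s)) \<le> A$1$2 * s"
      using s ge0 by (intro mult_left_mono) (auto simp: near_def)
    ultimately show ?thesis unfolding near_act_iff[OF adm s(1)] using A by (simp add: algebra_simps)
  qed
  then show ?thesis using d by blast
qed

lemma near_True_ge: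
  assumes "near k True e s" "s \<in> {0..1}" "0 < e"
  shows "e / (1 + e) \<le> s"
  using assms by (simp add: near_def pos_divide_le_eq algebra_simps)

lemma near_False_le:
  assumes "near k False e s" "s \<in> {0..1}" "0 < e" "0 < k"
  shows "e / (k + e) \<le> 1 - s"
proof -
  have "e * s \<le> k * (1 - s)" using assms(1) by (simp add: near_def)
  then have "e \<le> (1 - s) * (k + e)" by (simp add: algebra_simps)
  then show ?thesis using assms(3,4) by (simp add: pos_divide_le_eq)
qed

lemma word_cauchy_case2:
  assumes fin: "finite S" and adm: "\<And>A. A \<in> S \<Longrightarrow> admissible A" and t: "0 < t" "t < 1" and "case2 S"
  shows "word_cauchy S t"
proof -
  have upper: "A$1$1 < A$2$2" if "A \<in> S" "A$2$1 = 0" for A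
    using assms(5) that unfolding case2_iff by blast
  have lower: "A$2$2 < A$1$1" if "A \<in> S" "A$1$2 = 0" for A
    using assms(5) that unfolding case2_iff by blast
  have pair: "A$1$2 * B$2$1 < B$1$2 * A$2$1" if "A \<in> S" "B \<in> S" "A$2$2 = 0" "B$1$1 = 0" for A B
    using assms(5) that unfolding case2_iff by blast
  have ge0: "0 \<le> A$1$1" "0 \<le> A$1$2" "0 \<le> A$2$1" "0 \<le> A$2$2" "0 < A$1$1 + A$2$1" "0 < A$1$2 + A$2$2"
    if "A \<in> S" for A using adm[OF that] by (auto simp: admissible_iff)
  have pos11: "0 < A$1$2 \<and> 0 < A$2$1" if "A \<in> S" "A$1$1 = 0" for A
    using lower[OF that(1)] ge0[OF that(1)] that(2) by force
  have pos22: "0 < A$1$2 \<and> 0 < A$2$1" if "A \<in> S" "A$2$2 = 0" for A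
    using upper[OF that(1)] ge0[OF that(1)] that(2) by force
  define X where "X = {A \<in> S. A$2$2 = 0}"
  define Y where "Y = {B \<in> S. B$1$1 = 0}"
  obtain k where k: "0 < k" "\<And>x. x \<in> (\<lambda>A. A$1$2 / A$2$1) ` X \<Longrightarrow> x < k"
    "\<And>y. y \<in> (\<lambda>A. A$1$2 / A$2$1) ` Y \<Longrightarrow> k < y"
  proof (rule separate_finite_sets_strict)
    show "finite ((\<lambda>A. A$1$2 / A$2$1) ` X)" "finite ((\<lambda>A. A$1$2 / A$2$1) ` Y)"
      using fin by (auto simp: X_def Y_def)
  next
    fix y assume "y \<in> (\<lambda>A. A$1$2 / A$2$1) ` Y"
    then show "0 < y" using pos11 by (auto simp: Y_def)
  next
    fix x y assume "x \<in> (\<lambda>A. A$1$2 / A$2$1) ` X" "y \<in> (\<lambda>A. A$1$2 / A$2$1) ` Y"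
    then obtain A B where AB: "A \<in> X" "B \<in> Y" "x = A$1$2 / A$2$1" "y = B$1$2 / B$2$1" by blast
    then have "0 < A$2$1" "0 < B$2$1" using pos11[of B] pos22[of A] by (auto simp: X_def Y_def)
    then show "x < y" using AB(1,2) pair[of A B] unfolding AB(3,4) by (auto simp: X_def Y_def field_simps)
  qed blast
  have kX: "A$1$2 < k * A$2$1" if "A \<in> S" "A$2$2 = 0" for A
    using k(2)[of "A$1$2 / A$2$1"] pos22[OF that] that by (auto simp: X_def field_simps)
  have kY: "k * A$2$1 < A$1$2" if "A \<in> S" "A$1$1 = 0" for A
    using k(3)[of "A$1$2 / A$2$1"] pos11[OF that] that by (auto simp: Y_def field_simps)
  \<comment> \<open>In the coordinate \<open>r\<close> this is the interval from \<open>e\<close> to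
    \<open>k / e\<close>. Matrices with a zero on the diagonal interchange the roles of the ends, so
    both depend on the same \<open>e\<close>.\<close>
  define L where "L e = {s \<in> {0..1}. near k True e s \<and> near k False e s}" for e
  define P where "P A d \<longleftrightarrow> (\<forall>e. 0 < e \<and> e \<le> d \<longrightarrow> (\<forall>s\<in>L e. act A s \<in> L e))" for A d
  have "\<exists>d>0. d < 1 \<and> (\<forall>A\<in>S. P A d)"
  proof (rule finite_uniform_parameter[OF fin])
    fix A assume A: "A \<in> S"
    have "\<exists>d>0. \<forall>e. 0 < e \<and> e \<le> d \<longrightarrow> (\<forall>s\<in>L e. near k True e (act A s))"
    proof (cases "A$1$1 = 0")
      case True
      then show ?thesis using near_True_invariant_zero11[OF adm[OF A] _ kY[OF A]] unfolding L_def by blast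
    next
      case False
      then have "0 < A$1$1 \<and> 0 < A$1$2 \<or> A$1$2 = 0 \<and> A$2$2 < A$1$1"
        using ge0[OF A] lower[OF A] by force
      then show ?thesis using near_True_invariant[OF adm[OF A], of k] unfolding L_def by blast
    qed
    then obtain d1 where d1: "0 < d1" "\<And>e s. 0 < e \<Longrightarrow> e \<le> d1 \<Longrightarrow> s \<in> L e \<Longrightarrow> near k True e (act A s)"
      by blast
    have "\<exists>d>0. \<forall>e. 0 < e \<and> e \<le> d \<longrightarrow> (\<forall>s\<in>L e. near k False e (act A s))"
    proof (cases "A$2$2 = 0")
      case True
      then show ?thesis using near_False_invariant_zero22[OF adm[OF A] _ kX[OF A]] unfolding L_def by blast
    next
      case False
      then have "0 < A$2$1 \<and> 0 < A$2$2 \<or> A$2$1 = 0 \<and> A$1$1 < A$2$2"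
        using ge0[OF A] upper[OF A] by force
      then show ?thesis using near_False_invariant[OF adm[OF A] k(1)] unfolding L_def by blast
    qed
    then obtain d2 where d2: "0 < d2" "\<And>e s. 0 < e \<Longrightarrow> e \<le> d2 \<Longrightarrow> s \<in> L e \<Longrightarrow> near k False e (act A s)"
      by blast
    have "act A s \<in> {0..1}" if "s \<in> L e" for e s
      using act_in_unit[OF adm[OF A]] that unfolding L_def by blast
    then have "P A (min d1 d2)" using d1(2) d2(2) unfolding P_def L_def[of "_"] by (auto simp: L_def)
    then show "\<exists>d>0. P A d" using d1(1) d2(1) by (intro exI[of _ "min d1 d2"]) auto
  qed (auto simp: P_def)
  then obtain d where d: "0 < d" "\<And>A. A \<in> S \<Longrightarrow> P A d" by blast
  \<comment> \<open>The bound by \<open>d\<close> makes \<open>L e\<close> invariant, the other two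
    put \<open>t\<close> into it.\<close>
  define e where "e = min d (min t (k * (1 - t)))"
  have e: "0 < e" "e \<le> d" "e \<le> t" "e \<le> k * (1 - t)" using d t k(1) by (auto simp: e_def)
  show ?thesis
  proof (rule word_cauchy_if_contracting_or_advancing[OF fin adm, where K = "L e" and p = "\<lambda>_. True"])
    show L01: "L e \<subseteq> {0..1}" unfolding L_def by blast
    show inv: "act A x \<in> L e" if "A \<in> S" "x \<in> L e" for A x
      using d(2)[OF that(1)] e that(2) unfolding P_def by blast
    have "e * (1 - t) \<le> e * 1" "e * t \<le> e * 1" using e t by (intro mult_left_mono; simp)+
    then have "e * (1 - t) \<le> t" "e * t \<le> k * (1 - t)" using e by linarith+
    then show "t \<in> L e" using t by (simp add: L_def near_def)
    fix A B assume AB: "A \<in> S" "B \<in> S"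
    have "\<exists>d>0. contracting (L e) (1 - d) A B"
    proof (cases "0 < A$1$1 * A$2$1")
      case True
      have "e / (1 + e) \<le> act B x" if "x \<in> L e" for x
        using near_True_ge[of k e "act B x"] inv[OF AB(2) that] e(1) unfolding L_def by blast
      moreover have "0 < e / (1 + e)" using e(1) by simp
      ultimately show ?thesis
        using ex_contracting_row1[OF adm[OF AB(1)] adm[OF AB(2)] L01] True by blast
    next
      case False
      \<comment> \<open>Diagonal matrices are excluded by \<open>upper\<close> and
        \<open>lower\<close>, antidiagonal ones by \<open>pair\<close> for \<open>A\<close> and
        itself, so some column of \<open>A\<close> is positive.\<close>
      then have pos: "0 < A$1$2 * A$2$2"
        using ge0[OF AB(1)] upper[OF AB(1)] lower[OF AB(1)] pair[OF AB(1) AB(1)]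
        by (cases "A$2$2 = 0"; cases "A$1$2 = 0"; cases "A$1$1 = 0"; cases "A$2$1 = 0") auto
      have "e / (k + e) \<le> 1 - act B x" if "x \<in> L e" for x
        using near_False_le[of k e "act B x"] inv[OF AB(2) that] e(1) k(1) unfolding L_def by blast
      moreover have "0 < e / (k + e)" using e(1) k(1) by simp
      ultimately show ?thesis
        using ex_contracting_row2[OF adm[OF AB(1)] adm[OF AB(2)] L01] pos by blast
    qed
    \<comment> \<open>Every pair contracts; the constant values \<open>True\<close> and
      \<open>False\<close> of \<open>p\<close> and \<open>q\<close> make the second alternative
      void.\<close>
    then show "\<exists>d>0. contracting (L e) (1 - d) A B \<or> True = False \<and> advancing (L e) k d True False A"
      by simp
  qed (use k in auto)
qed

text \<open>Only the distance to the second axis has to be kept. Upper triangular matrices may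
  approach the first axis because they advance towards it; all others have a positive first column
  and contract.\<close>

lemma word_cauchy_case3:
  assumes fin: "finite S" and adm: "\<And>A. A \<in> S \<Longrightarrow> admissible A" and t: "0 < t" "t < 1" and "case3 S"
  shows "word_cauchy S t"
proof -
  have upper: "A$2$2 \<le> A$1$1" if "A \<in> S" "A$2$1 = 0" for A
    using assms(5) that unfolding case3_iff by blast
  have lower: "A$2$2 < A$1$1" if "A \<in> S" "A$1$2 = 0" for A
    using assms(5) that unfolding case3_iff by blast
  have nz: "A$1$1 \<noteq> 0" if "A \<in> S" for A
    using assms(5) that unfolding case3_iff by blast
  have ge0: "0 < A$1$1" "0 \<le> A$1$2" "0 \<le> A$2$1" "0 \<le> A$2$2"
    if "A \<in> S" for A using adm[OF that] nz[OF that] by (auto simp: admissible_iff)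
  define L where "L e = {s \<in> {0..1}. near 1 True e s}" for e
  define P where "P A d \<longleftrightarrow> (\<forall>e. 0 < e \<and> e \<le> d \<longrightarrow> (\<forall>s\<in>L e. act A s \<in> L e))" for A d
  have "\<exists>d>0. d < 1 \<and> (\<forall>A\<in>S. P A d)"
  proof (rule finite_uniform_parameter[OF fin])
    fix A assume A: "A \<in> S"
    have "0 < A$1$1 \<and> 0 < A$1$2 \<or> A$1$2 = 0 \<and> A$2$2 < A$1$1"
      using ge0[OF A] lower[OF A] by force
    then show "\<exists>d>0. P A d"
      using near_True_invariant[OF adm[OF A], of 1] act_in_unit[OF adm[OF A]] unfolding P_def L_def by blast
  qed (auto simp: P_def)
  then obtain d where d: "0 < d" "\<And>A. A \<in> S \<Longrightarrow> P A d" by blast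
  define e where "e = min d t"
  have e: "0 < e" "e \<le> d" "e \<le> t" using d t by (auto simp: e_def)
  have L_ge: "L e \<subseteq> {e / (1 + e)..1}" using near_True_ge e(1) by (auto simp: L_def)
  have \<eta>: "0 < e / (1 + e)" using e(1) by simp
  show ?thesis
  proof (rule word_cauchy_if_contracting_or_advancing[OF fin adm, where K = "L e" and k = 1
        and p = "\<lambda>_. True" and q = "\<lambda>_. True"])
    show L01: "L e \<subseteq> {0..1}" unfolding L_def by blast
    show inv: "act A x \<in> L e" if "A \<in> S" "x \<in> L e" for A x
      using d(2)[OF that(1)] e that(2) unfolding P_def by blast
    have "e * (1 - t) \<le> e * 1" using e t by (intro mult_left_mono) auto
    then have "e * (1 - t) \<le> t" using e by linarith
    then show "t \<in> L e" using t by (simp add: L_def near_def)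
    fix A B assume AB: "A \<in> S" "B \<in> S"
    show "\<exists>d>0. contracting (L e) (1 - d) A B \<or> True = True \<and> advancing (L e) 1 d True True A"
    proof (cases "A$2$1 = 0")
      case True
      consider "0 < A$1$2" | "A$2$2 < A$1$1" using ge0[OF AB(1)] lower[OF AB(1)] by force
      then have "\<exists>d>0. advancing (L e) 1 d True True A"
        using ex_advancing_upper[OF adm[OF AB(1)] L01 True upper[OF AB(1) True], of 1]
          ex_advancing_upper_away[OF adm[OF AB(1)] \<eta> L_ge True, of 1] by cases
      then show ?thesis by blast
    next
      case False
      then have "0 < A$1$1 * A$2$1" using ge0[OF AB(1)] by simp
      moreover have "e / (1 + e) \<le> act B x" if "x \<in> L e" for x
        using subsetD[OF L_ge inv[OF AB(2) that]] by simp
      ultimately show ?thesis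
        using ex_contracting_row1[OF adm[OF AB(1)] adm[OF AB(2)] L01 \<eta>] by blast
    qed
  qed auto
qed

subsection \<open>Exchanging the coordinates\<close>

text \<open>Conjugation by the exchange of coordinates, which replaces \<open>t\<close> by
  \<open>1 - t\<close>.\<close>

definition mirror :: "real^2^2 \<Rightarrow> real^2^2" where
  "mirror A = mat2 (A$2$2) (A$2$1) (A$1$2) (A$1$1)"

lemma mirror_nth [simp]:
  "mirror A $ 1 $ 1 = A$2$2" "mirror A $ 1 $ 2 = A$2$1"
  "mirror A $ 2 $ 1 = A$1$2" "mirror A $ 2 $ 2 = A$1$1"
  by (simp_all add: mirror_def)

lemma mirror_mirror [simp]: "mirror (mirror A) = A"
  by (simp add: mirror_def mat2_eta)

lemma admissible_mirror: "admissible A \<Longrightarrow> admissible (mirror A)"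
  by (auto simp: admissible_iff)

lemma act_mirror:
  assumes "admissible A" "t \<in> {0..1}"
  shows "act (mirror A) (1 - t) = 1 - act A t"
  unfolding one_minus_act[OF assms] by (simp add: act_def mass_def algebra_simps)

lemma foldr_act_mirror:
  assumes "\<And>A. A \<in> S \<Longrightarrow> admissible A" "t \<in> {0..1}" "u \<in> lists S"
  shows "foldr act (map mirror u) (1 - t) = 1 - foldr act u t"
  using assms(3)
proof (induction u)
  case (Cons A u)
  have "foldr act u t \<in> {0..1}"
    by (rule foldr_invariant[of S]) (use assms(1,2) Cons.hyps act_in_unit in blast)+
  then show ?case using Cons assms(1) by (simp add: act_mirror)
qed simp

lemma word_cauchy_mirror:
  assumes adm: "\<And>A. A \<in> S \<Longrightarrow> admissible A" and t: "t \<in> {0..1}" and "word_cauchy S t"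
  shows "word_cauchy (mirror ` S) (1 - t)"
  unfolding word_cauchy_def
proof (intro allI impI)
  fix e :: real assume "0 < e"
  then obtain N where N: "\<And>u w. u \<in> lists S \<Longrightarrow> w \<in> lists S \<Longrightarrow> N \<le> length u \<Longrightarrow>
      \<bar>foldr act (u @ w) t - foldr act u t\<bar> < e"
    using assms(3) unfolding word_cauchy_def by blast
  have "\<bar>foldr act (u @ w) (1 - t) - foldr act u (1 - t)\<bar> < e"
    if uw: "u \<in> lists (mirror ` S)" "w \<in> lists (mirror ` S)" and "N \<le> length u" for u w
  proof -
    obtain u' w' where u': "u' \<in> lists S" "u = map mirror u'" and w': "w' \<in> lists S" "w = map mirror w'"
      using uw unfolding lists_image by blast
    then have "\<bar>foldr act (u' @ w') t - foldr act u' t\<bar> < e" using N that(3) by simp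
    moreover have "foldr act (u @ w) (1 - t) = 1 - foldr act (u' @ w') t"
      using foldr_act_mirror[of S t "u' @ w'"] adm t u' w' by simp
    moreover have "foldr act u (1 - t) = 1 - foldr act u' t"
      using foldr_act_mirror[of S t u'] adm t u' by simp
    ultimately show ?thesis by linarith
  qed
  then show "\<exists>N. \<forall>u\<in>lists (mirror ` S). \<forall>w\<in>lists (mirror ` S). N \<le> length u \<longrightarrow>
      \<bar>foldr act (u @ w) (1 - t) - foldr act u (1 - t)\<bar> < e" by blast
qed

lemma case3_mirror: "case3 (mirror ` S) \<longleftrightarrow> case4 S"
  unfolding case3_iff case4_iff by auto

lemma case4_mirror: "case4 (mirror ` S) \<longleftrightarrow> case3 S"
  unfolding case3_iff case4_iff by auto

text \<open>The two triangular conditions change places; the mirror images of a pair, in reverse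
  order, satisfy the same inequality.\<close>

lemma case2_mirror: "case2 (mirror ` S) \<longleftrightarrow> case2 S"
  unfolding case2_iff by (auto simp: mult.commute)

lemma word_cauchy_case4:
  assumes fin: "finite S" and adm: "\<And>A. A \<in> S \<Longrightarrow> admissible A" and t: "0 < t" "t < 1" and "case4 S"
  shows "word_cauchy S t"
proof -
  have adm': "admissible A" if "A \<in> mirror ` S" for A using that adm admissible_mirror by blast
  have "word_cauchy (mirror ` S) (1 - t)"
    by (rule word_cauchy_case3[OF _ adm']) (use assms in \<open>auto simp: case3_mirror\<close>)
  then have "word_cauchy (mirror ` mirror ` S) (1 - (1 - t))"
    using t word_cauchy_mirror[of "mirror ` S" "1 - t"] adm' by simp
  then show ?thesis by (simp add: image_image)
qed

lemma admissible_mult: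
  assumes "admissible A" "admissible B"
  shows "admissible (A ** B)"
proof -
  have "0 < (A$1$1 + A$2$1) * B$1$j + (A$1$2 + A$2$2) * B$2$j" if "0 < B$1$j + B$2$j" "0 \<le> B$1$j" "0 \<le> B$2$j" for j
    using assms(1) that by (cases "B$1$j = 0") (auto simp: admissible_iff intro!: add_pos_nonneg)
  from this[of 1] this[of 2] show ?thesis
    using assms by (simp add: admissible_iff matrix_mult_entries algebra_simps)
qed

subsection \<open>Necessity\<close>

lemma act_scalar:
  assumes "admissible A" "A$1$2 = 0" "A$2$1 = 0" "A$1$1 = A$2$2"
  shows "act A t = t"
proof -
  have "A$2$2 \<noteq> 0" using assms by (simp add: admissible_iff)
  moreover have "mass A t = A$2$2" using assms by (simp add: mass_def algebra_simps)
  ultimately show ?thesis using assms by (simp add: act_def)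
qed

lemma foldr_concat_replicate: "foldr f (concat (replicate n u)) x = (foldr f u ^^ n) x"
  by (induction n) simp_all

lemma le_length_concat_replicate: "u \<noteq> [] \<Longrightarrow> n \<le> length (concat (replicate n u))"
  by (induction n) (auto simp: Suc_le_eq neq_Nil_conv)

lemma concat_replicate_in_lists: "u \<in> lists S \<Longrightarrow> concat (replicate n u) \<in> lists S"
  by (induction n) auto

text \<open>Copies of \<open>u\<close> in front make the word long without moving \<open>t\<close>
  or \<open>act A t\<close>, so the Cauchy bound applies to these two points themselves.\<close>

lemma fixed_if_identity_word:
  assumes "word_cauchy S t" "u \<in> lists S" "u \<noteq> []" "foldr act u t = t" "A \<in> S"
    and id: "foldr act u (act A t) = act A t"
  shows "act A t = t"
proof (rule ccontr)
  assume "act A t \<noteq> t"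
  then obtain N where N: "\<And>u w. u \<in> lists S \<Longrightarrow> w \<in> lists S \<Longrightarrow> N \<le> length u \<Longrightarrow>
      \<bar>foldr act (u @ w) t - foldr act u t\<bar> < \<bar>act A t - t\<bar>"
    using assms(1) unfolding word_cauchy_def by (metis zero_less_abs_iff right_minus_eq)
  have "(foldr act u ^^ N) x = x" if "foldr act u x = x" for x
    using that by (induction N) simp_all
  then show False
    using N[of "concat (replicate N u)" "[A]"] le_length_concat_replicate[OF assms(3)]
      concat_replicate_in_lists[OF assms(2)] assms(4,5) id
    by (simp add: foldr_concat_replicate)
qed

lemma continuous_on_foldr_act:
  assumes "\<And>A. A \<in> S \<Longrightarrow> admissible A" "u \<in> lists S"
  shows "continuous_on {0..1} (foldr act u)"
  using assms(2)
proof (induction u)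
  case (Cons A u)
  have "foldr act u ` {0..1} \<subseteq> {0..1}"
    using foldr_invariant[of S "{0..1}" act u] act_in_unit assms(1) Cons.hyps by blast
  then show ?case
    using Cons assms(1) continuous_on_compose2[OF continuous_on_act, of A "{0..1}" "foldr act u"] by simp
qed simp

text \<open>Lets one-letter and two-letter words enter the necessity argument alike, through the
  entries of one matrix with the same action.\<close>

definition represents :: "(real^2^2) list \<Rightarrow> real^2^2 \<Rightarrow> bool" where
  "represents u A \<longleftrightarrow> u \<noteq> [] \<and> admissible A \<and> (\<forall>x\<in>{0..1}. foldr act u x = act A x)"

lemma represents_single: "admissible A \<Longrightarrow> represents [A] A"
  by (simp add: represents_def)

lemma represents_pair: "admissible A \<Longrightarrow> admissible B \<Longrightarrow> represents [A, B] (A ** B)"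
  by (simp add: represents_def admissible_mult act_mult)

text \<open>Prefixing \<open>N\<close> copies of \<open>u\<close> keeps \<open>t\<close> away from the repelling fixed point \<open>1\<close> of the action
  of \<open>A\<close>, but hardly moves the points \<open>foldr act (w n) t\<close> for large \<open>n\<close>.\<close>

lemma not_tendsto_repelling:
  assumes adm: "\<And>A. A \<in> S \<Longrightarrow> admissible A" and t: "0 < t" "t < 1" and wc: "word_cauchy S t"
    and u: "u \<in> lists S" "represents u A" and A: "A$2$1 = 0" "A$1$1 < A$2$2"
    and w: "\<And>n::nat. w n \<in> lists S"
  shows "\<not> (\<lambda>n. foldr act (w n) t) \<longlonglongrightarrow> 1"
proof
  assume lim: "(\<lambda>n. foldr act (w n) t) \<longlonglongrightarrow> 1"
  have uA: "u \<noteq> []" "admissible A" "\<And>x. x \<in> {0..1} \<Longrightarrow> foldr act u x = act A x"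
    using u(2) by (auto simp: represents_def)
  obtain d where d: "0 < d"
    "\<And>e s. 0 < e \<Longrightarrow> e \<le> d \<Longrightarrow> s \<in> {0..1} \<Longrightarrow> near 1 False e s \<Longrightarrow> near 1 False e (act A s)"
    using near_False_invariant[OF uA(2), of 1] A by auto
  define e where "e = min d (1 - t)"
  have e: "0 < e" "e \<le> d" "e \<le> 1 - t" using d t by (auto simp: e_def)
  \<comment> \<open>This bounds \<open>1 - s\<close> from below for all \<open>s\<close> in the
    orbit of \<open>t\<close> under \<open>u\<close>, whatever the number of repetitions, so
    \<open>N\<close> may be chosen afterwards.\<close>
  define \<eta> where "\<eta> = e / (1 + e)"
  have "0 < \<eta>" using e(1) by (simp add: \<eta>_def)
  then have \<eta>: "0 < \<eta> / 2" "\<eta> / 2 < \<eta>" by simp_all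
  obtain N where N: "\<And>u w. u \<in> lists S \<Longrightarrow> w \<in> lists S \<Longrightarrow> N \<le> length u \<Longrightarrow>
      \<bar>foldr act (u @ w) t - foldr act u t\<bar> < \<eta> / 2"
    using wc \<eta>(1) unfolding word_cauchy_def by blast
  let ?F = "foldr act (concat (replicate N u))"
  have F_eq: "?F = foldr act u ^^ N" by (rule ext) (rule foldr_concat_replicate)
  have "(foldr act u ^^ N) t \<in> {0..1} \<and> near 1 False e ((foldr act u ^^ N) t)"
  proof (induction N)
    case 0
    have "e * t \<le> e * 1" using e t by (intro mult_left_mono) auto
    then have "e * t \<le> 1 - t" using e by linarith
    then show ?case using t by (simp add: near_def)
  next
    case (Suc n)
    then show ?case using uA(2,3) d(2)[OF e(1,2)] act_in_unit by simp
  qed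
  then have "\<eta> \<le> 1 - ?F t"
    using near_False_le[of 1 e "?F t"] e(1) unfolding F_eq \<eta>_def by simp
  have w01: "foldr act (w n) t \<in> {0..1}" for n
    using foldr_invariant[of S "{0..1}" act "w n" t] w adm act_in_unit t by simp
  have "act A 1 = 1" using A(1) uA(2) by (simp add: act_def mass_def admissible_iff)
  then have "(foldr act u ^^ n) 1 = 1" for n
    by (induction n) (simp_all add: uA(3))
  then have "?F 1 = 1" unfolding F_eq .
  have cont: "continuous_on {0..1} ?F"
    using continuous_on_foldr_act[of S "concat (replicate N u)"] concat_replicate_in_lists[OF u(1)] adm
    by blast
  have "(\<lambda>n. ?F (foldr act (w n) t)) \<longlonglongrightarrow> ?F 1"
    by (rule continuous_on_tendsto_compose[OF cont lim]) (use w01 in auto)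
  moreover have "?F (foldr act (w n) t) \<le> ?F t + \<eta> / 2" for n
    using N[OF concat_replicate_in_lists[OF u(1)] w[of n] le_length_concat_replicate[OF uA(1)]]
    unfolding foldr_append comp_apply by linarith
  \<comment> \<open>The limit is taken in \<open>n\<close> with \<open>N\<close> fixed.\<close>
  ultimately have "?F 1 \<le> ?F t + \<eta> / 2" by (intro LIMSEQ_le_const2) auto
  then show False using \<open>?F 1 = 1\<close> \<open>\<eta> \<le> 1 - ?F t\<close> \<eta> by linarith
qed

text \<open>For \<open>A$2$2 > 0\<close> the action on \<open>r\<close> is affine with slope at
  least \<open>1\<close> and not the identity, so the orbit of a positive \<open>r\<close> tends to
  infinity.\<close>

lemma tendsto_one_if_upper:
  assumes t: "0 < t" "t < 1" and v: "represents v A"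
    and A: "A$2$1 = 0" "A$2$2 \<le> A$1$1" "A$1$2 \<noteq> 0 \<or> A$2$2 \<noteq> A$1$1"
  shows "(\<lambda>n. foldr act (concat (replicate n v)) t) \<longlonglongrightarrow> 1"
proof -
  have vA: "admissible A" "\<And>x. x \<in> {0..1} \<Longrightarrow> foldr act v x = act A x"
    using v by (auto simp: represents_def)
  have K: "{t..1} \<subseteq> {0..1}" using t by auto
  have "\<exists>d>0. advancing {t..1} 1 d True True A"
  proof (cases "A$1$2 = 0")
    case True
    then show ?thesis using ex_advancing_upper_away[OF vA(1) t(1) order_refl A(1)] A by simp
  next
    case False
    then show ?thesis
      using ex_advancing_upper[OF vA(1) K A(1,2)] vA(1) by (simp add: admissible_iff less_le)
  qed
  then obtain d where d: "0 < d" "advancing {t..1} 1 d True True A" by blast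
  \<comment> \<open>No point moves to the left, so the orbit stays in the interval on which the gain
    is bounded below.\<close>
  have up: "act A s \<in> {t..1}" if s: "s \<in> {t..1}" for s
  proof -
    have s01: "s \<in> {0..1}" using s K by blast
    have m: "0 < mass A s" by (rule mass_pos[OF vA(1) s01])
    have "A$2$2 * s \<le> A$1$1 * s" "0 \<le> A$1$2 * (1 - s)"
      using A(2) s01 vA(1) by (auto intro: mult_right_mono simp: admissible_iff)
    then have "A$2$2 \<le> mass A s" using A(1) by (simp add: mass_def algebra_simps)
    then have "A$2$2 * (1 - s) \<le> mass A s * (1 - s)" using s01 by (intro mult_right_mono) auto
    then have "1 - act A s \<le> 1 - s"
      unfolding one_minus_act[OF vA(1) s01] using A(1) m by (simp add: pos_divide_le_eq mult.commute)
    then show ?thesis using s act_in_unit[OF vA(1) s01] by auto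
  qed
  define x where "x n = foldr act (concat (replicate n v)) t" for n
  have x: "x n \<in> {t..1} \<and> near 1 True (of_nat n * d) (x n)" for n
  proof (induction n)
    case 0
    then show ?case using t by (simp add: x_def near_def)
  next
    case (Suc n)
    have "x (Suc n) = act A (x n)" using Suc K vA(2) by (auto simp: x_def)
    moreover have "near 1 True (of_nat n * d + d) (act A (x n))"
      using d Suc unfolding advancing_def by simp
    ultimately show ?case using up Suc by (simp add: algebra_simps)
  qed
  have "(\<lambda>n. x n) \<longlonglongrightarrow> 1"
  proof (rule LIMSEQ_I)
    fix r :: real assume r: "0 < r"
    obtain N where N: "1 / r < of_nat N * d" using reals_Archimedean3[OF d(1)] by blast
    have "norm (x n - 1) < r" if "N \<le> n" for n
    proof -
      have "of_nat N * d \<le> of_nat n * d" using that d(1) by simp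
      then have "1 / r < 1 + of_nat n * d" using N by simp
      then have lt: "1 / (1 + of_nat n * d) < r" using r d(1)
        by (simp add: pos_divide_less_eq add_pos_nonneg mult.commute)
      have "\<bar>x n - 1\<bar> \<le> max 1 1 / (max 1 1 + of_nat n * d)"
        using x[of n] t d(1) by (intro near_diff[of 1 True]) (auto simp: near_def)
      then show ?thesis using lt by simp
    qed
    then show "\<exists>N. \<forall>n\<ge>N. norm (x n - 1) < r" by blast
  qed
  then show ?thesis by (simp add: x_def)
qed

text \<open>The assumption \<open>not_fixed\<close> sets case 5 aside. As a locale, all results can
  be instantiated with the mirrored set as well.\<close>

locale convergent_not_fixed =
  fixes S :: "(real^2^2) set" and t :: real
  assumes adm: "\<And>A. A \<in> S \<Longrightarrow> admissible A" and t: "0 < t" "t < 1"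
    and wc: "word_cauchy S t" and not_fixed: "\<not> (\<forall>A\<in>S. act A t = t)"
begin

lemma mirrored: "convergent_not_fixed (mirror ` S) (1 - t)"
proof
  show "admissible A" if "A \<in> mirror ` S" for A using that adm admissible_mirror by blast
  show "word_cauchy (mirror ` S) (1 - t)" using word_cauchy_mirror[of S t] adm wc t by simp
  show "\<not> (\<forall>A\<in>mirror ` S. act A (1 - t) = 1 - t)" using not_fixed act_mirror adm t by simp
qed (use t in auto)

lemma not_scalar:
  assumes "u \<in> lists S" "represents u A" "A$1$2 = 0" "A$2$1 = 0"
  shows "A$1$1 \<noteq> A$2$2"
proof
  assume "A$1$1 = A$2$2"
  then have id: "foldr act u x = x" if "x \<in> {0..1}" for x
    using act_scalar[of A x] assms that by (auto simp: represents_def)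
  have "act B t = t" if B: "B \<in> S" for B
  proof (rule fixed_if_identity_word[OF wc assms(1) _ _ B])
    show "foldr act u (act B t) = act B t" using act_in_unit[OF adm[OF B], of t] t by (intro id) auto
  qed (use assms(2) t id in \<open>auto simp: represents_def\<close>)
  with not_fixed show False by blast
qed

lemma upper_words_repelling:
  assumes "u \<in> lists S" "represents u A" "A$2$1 = 0" "A$1$1 < A$2$2"
    and B: "v \<in> lists S" "represents v B" "B$2$1 = 0"
  shows "B$1$1 < B$2$2"
proof (rule ccontr)
  assume "\<not> ?thesis"
  then have "(\<lambda>n. foldr act (concat (replicate n v)) t) \<longlonglongrightarrow> 1"
    using not_scalar[OF B(1,2)] B by (intro tendsto_one_if_upper[OF t B(2)]) auto
  then show False
    using not_tendsto_repelling[of S t u A "\<lambda>n. concat (replicate n v)"] adm t wc assms(1-4)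
      concat_replicate_in_lists[OF B(1)] by blast
qed

text \<open>The product \<open>A ** B\<close> is upper triangular with diagonal entries
  \<open>A$1$2 * B$2$1\<close> and \<open>A$2$1 * B$1$2\<close>; this is the origin of the condition
  on pairs.\<close>

lemma pair_repelling:
  assumes "u \<in> lists S" "represents u C" "C$2$1 = 0" "C$1$1 < C$2$2"
    and AB: "A \<in> S" "B \<in> S" "A$2$2 = 0" "B$1$1 = 0"
  shows "A$1$2 * B$2$1 < B$1$2 * A$2$1"
  using upper_words_repelling[OF assms(1-4), of "[A, B]" "A ** B"] represents_pair[of A B] adm AB
  by (simp add: matrix_mult_entries mult.commute)

lemma case2_or_case4_if_repelling_upper:
  assumes A: "A \<in> S" "A$2$1 = 0" "A$1$1 < A$2$2"
  shows "case2 S \<or> case4 S"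
proof -
  interpret m: convergent_not_fixed "mirror ` S" "1 - t" by (rule mirrored)
  have A': "[A] \<in> lists S" "represents [A] A" using A adm represents_single by auto
  have upper: "B$1$1 < B$2$2" if "B \<in> S" "B$2$1 = 0" for B
    using upper_words_repelling[OF A' A(2,3), of "[B]" B] that adm represents_single by auto
  show ?thesis
  proof (cases "\<forall>B\<in>S. B$1$2 = 0 \<longrightarrow> B$2$2 < B$1$1")
    case True
    then show ?thesis
      using upper pair_repelling[OF A' A(2,3)] unfolding case2_iff by blast
  next
    case False
    \<comment> \<open>Powers of \<open>B\<close> draw \<open>t\<close> to the second axis.\<close>
    then obtain B where B: "B \<in> S" "B$1$2 = 0" "B$1$1 \<le> B$2$2" by force
    have rep: "[mirror C] \<in> lists (mirror ` S)" "represents [mirror C] (mirror C)" if "C \<in> S" for C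
      using that adm represents_single admissible_mirror by auto
    have lower: "C$1$1 \<le> C$2$2" if C: "C \<in> S" "C$1$2 = 0" for C
      using m.upper_words_repelling[OF rep[OF C(1)] _ _ rep[OF B(1)]] B C by force
    \<comment> \<open>Otherwise \<open>C\<close> sends the second axis to the first, and
      \<open>C\<close> in front of powers of \<open>B\<close> brings \<open>t\<close> arbitrarily
      close to the axis that \<open>A\<close> repels from.\<close>
    have "C$2$2 \<noteq> 0" if C: "C \<in> S" for C
    proof
      assume "C$2$2 = 0"
      have "(\<lambda>n. foldr act (concat (replicate n [mirror B])) (1 - t)) \<longlonglongrightarrow> 1"
        using m.not_scalar[OF rep[OF B(1)]] B by (intro tendsto_one_if_upper[OF m.t rep(2)[OF B(1)]]) auto
      moreover have "foldr act (concat (replicate n [mirror B])) (1 - t)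
          = 1 - foldr act (concat (replicate n [B])) t" for n
        using foldr_act_mirror[of S t "concat (replicate n [B])"] adm t B(1)
          concat_replicate_in_lists[of "[B]" S] by (simp add: map_concat)
      ultimately have "(\<lambda>n. 1 - (1 - foldr act (concat (replicate n [B])) t)) \<longlonglongrightarrow> 1 - 1"
        by (intro tendsto_diff tendsto_const) simp
      then have lim: "(\<lambda>n. foldr act (concat (replicate n [B])) t) \<longlonglongrightarrow> 0" by simp
      have in01: "foldr act (concat (replicate n [B])) t \<in> {0..1}" for n
        using foldr_invariant[of S "{0..1}" act "concat (replicate n [B])" t] adm act_in_unit t B(1)
          concat_replicate_in_lists[of "[B]" S] by simp
      have "(\<lambda>n. act C (foldr act (concat (replicate n [B])) t)) \<longlonglongrightarrow> act C 0"
        by (rule continuous_on_tendsto_compose[OF continuous_on_act[OF adm[OF C]] lim]) (use in01 in auto)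
      moreover have "act C 0 = 1"
        using \<open>C$2$2 = 0\<close> adm[OF C] by (simp add: act_def mass_def admissible_iff)
      ultimately have "(\<lambda>n. foldr act (C # concat (replicate n [B])) t) \<longlonglongrightarrow> 1" by simp
      then show False
        using not_tendsto_repelling[of S t "[A]" A "\<lambda>n. C # concat (replicate n [B])"] adm t wc A' A(2,3)
          concat_replicate_in_lists[of "[B]" S] B(1) C by simp
    qed
    then show ?thesis using upper lower unfolding case4_iff by blast
  qed
qed

text \<open>\<open>A ** B\<close> is upper and \<open>B ** A\<close> lower triangular, with the same
  diagonal entries in opposite order, so both axes are repelling.\<close>

lemma case2_if_repelling_pair:
  assumes AB: "A \<in> S" "B \<in> S" "A$2$2 = 0" "B$1$1 = 0" "A$1$2 * B$2$1 < B$1$2 * A$2$1"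
  shows "case2 S"
proof -
  interpret m: convergent_not_fixed "mirror ` S" "1 - t" by (rule mirrored)
  have w: "[A, B] \<in> lists S" "represents [A, B] (A ** B)" "(A ** B)$2$1 = 0"
      "(A ** B)$1$1 < (A ** B)$2$2"
    using AB adm represents_pair by (auto simp: matrix_mult_entries mult.commute)
  \<comment> \<open>This word represents the mirror image of \<open>B ** A\<close>.\<close>
  have w': "[mirror B, mirror A] \<in> lists (mirror ` S)"
      "represents [mirror B, mirror A] (mirror B ** mirror A)"
      "(mirror B ** mirror A)$2$1 = 0" "(mirror B ** mirror A)$1$1 < (mirror B ** mirror A)$2$2"
    using AB adm represents_pair admissible_mirror by (auto simp: matrix_mult_entries mult.commute)
  have "C$1$1 < C$2$2" if "C \<in> S" "C$2$1 = 0" for C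
    using upper_words_repelling[OF w, of "[C]" C] that adm represents_single by auto
  moreover have "C$2$2 < C$1$1" if "C \<in> S" "C$1$2 = 0" for C
    using m.upper_words_repelling[OF w', of "[mirror C]" "mirror C"] that adm represents_single
      admissible_mirror by auto
  ultimately show ?thesis using pair_repelling[OF w] unfolding case2_iff by blast
qed

lemma some_case: "case1 S \<or> case2 S \<or> case3 S \<or> case4 S"
proof -
  interpret m: convergent_not_fixed "mirror ` S" "1 - t" by (rule mirrored)
  consider A where "A \<in> S" "A$2$1 = 0" "A$1$1 < A$2$2"
    | A where "A \<in> S" "A$1$2 = 0" "A$2$2 < A$1$1"
    | A B where "A \<in> S" "B \<in> S" "A$2$2 = 0" "B$1$1 = 0" "A$1$2 * B$2$1 < B$1$2 * A$2$1"
    | "\<forall>A\<in>S. A$2$1 = 0 \<longrightarrow> \<not> A$1$1 < A$2$2" "\<forall>A\<in>S. A$1$2 = 0 \<longrightarrow> \<not> A$2$2 < A$1$1"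
      "\<forall>A\<in>S. \<forall>B\<in>S. A$2$2 = 0 \<longrightarrow> B$1$1 = 0 \<longrightarrow> \<not> A$1$2 * B$2$1 < B$1$2 * A$2$1"
    by blast
  then show ?thesis
  proof cases
    case 1
    then show ?thesis using case2_or_case4_if_repelling_upper by blast
  next
    case 2
    then have "case2 (mirror ` S) \<or> case4 (mirror ` S)"
      by (intro m.case2_or_case4_if_repelling_upper[of "mirror A"]) auto
    then show ?thesis unfolding case2_mirror case4_mirror by blast
  next
    case 3
    then show ?thesis using case2_if_repelling_pair by blast
  next
    case 4
    note 4 = 4[unfolded not_less]
    \<comment> \<open>By the two triangular conditions a diagonal matrix would be scalar; the square
      of an antidiagonal one is scalar.\<close>
    have "\<not> (A$1$2 = 0 \<and> A$2$1 = 0)" if A: "A \<in> S" for A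
      using not_scalar[of "[A]" A] represents_single[OF adm[OF A]] A 4(1,2) by force
    moreover have "\<not> (A$1$1 = 0 \<and> A$2$2 = 0)" if A: "A \<in> S" for A
      using not_scalar[of "[A, A]" "A ** A"] represents_pair[OF adm[OF A] adm[OF A]] A
      by (auto simp: matrix_mult_entries mult.commute)
    ultimately have "case1 S" using 4 unfolding case1_iff by blast
    then show ?thesis by blast
  qed
qed

end

lemma word_cauchy_if_fixed:
  assumes "\<And>A. A \<in> S \<Longrightarrow> act A t = t"
  shows "word_cauchy S t"
proof -
  have "foldr act u t = t" if "u \<in> lists S" for u
    using that by (induction u) (simp_all add: assms)
  then show ?thesis unfolding word_cauchy_def by (auto simp del: foldr_append)
qed

lemma word_cauchy_iff:
  assumes "finite S" "\<And>A. A \<in> S \<Longrightarrow> admissible A" "0 < t" "t < 1"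
  shows "word_cauchy S t \<longleftrightarrow> case1 S \<or> case2 S \<or> case3 S \<or> case4 S \<or> (\<forall>A\<in>S. act A t = t)"
proof
  assume "word_cauchy S t"
  then show "case1 S \<or> case2 S \<or> case3 S \<or> case4 S \<or> (\<forall>A\<in>S. act A t = t)"
    using convergent_not_fixed.some_case[of S t] assms unfolding convergent_not_fixed_def by blast
next
  assume "case1 S \<or> case2 S \<or> case3 S \<or> case4 S \<or> (\<forall>A\<in>S. act A t = t)"
  then show "word_cauchy S t"
    using word_cauchy_case1[of S t] word_cauchy_case2[of S t] word_cauchy_case3[of S t]
      word_cauchy_case4[of S t] word_cauchy_if_fixed[of S t] assms by fastforce
qed

subsection \<open>Uniform convergence\<close>

lemma normalized_nth_1: "normalized X $ 1 = X$1 / (X$1 + X$2)"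
  by (simp add: normalized_def)

lemma normalized_nth_2: "X$1 + X$2 \<noteq> 0 \<Longrightarrow> normalized X $ 2 = 1 - X$1 / (X$1 + X$2)"
  by (simp add: normalized_def field_simps)

lemma matrix_vector_mult_nth_2:
  fixes A :: "real^2^2"
  shows "(A *v X)$i = A$i$1 * X$1 + A$i$2 * X$2"
  by (simp add: matrix_vector_mult_def sum_2)

lemma admissible_mult_vector:
  assumes "admissible A" "0 \<le> X$1" "0 \<le> X$2" "0 < X$1 + X$2"
  shows "0 \<le> (A *v X)$1" "0 \<le> (A *v X)$2" "0 < (A *v X)$1 + (A *v X)$2"
    "(A *v X)$1 / ((A *v X)$1 + (A *v X)$2) = act A (X$1 / (X$1 + X$2))"
proof -
  let ?s = "X$1 + X$2" and ?t = "X$1 / (X$1 + X$2)"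
  have t: "?t \<in> {0..1}" using assms by simp
  have X: "X$1 = ?s * ?t" "X$2 = ?s * (1 - ?t)" using assms(4) by (simp_all add: field_simps)
  show "0 \<le> (A *v X)$1" "0 \<le> (A *v X)$2"
    using assms by (simp_all add: matrix_vector_mult_nth_2 admissible_iff)
  have num: "(A *v X)$1 = ?s * (A$1$1 * ?t + A$1$2 * (1 - ?t))"
  proof -
    have "(A *v X)$1 = A$1$1 * (?s * ?t) + A$1$2 * (?s * (1 - ?t))"
      unfolding matrix_vector_mult_nth_2 X[symmetric] ..
    then show ?thesis by (simp only: distrib_left mult.left_commute)
  qed
  have sum: "(A *v X)$1 + (A *v X)$2 = ?s * mass A ?t"
  proof -
    have "(A *v X)$1 + (A *v X)$2 = (A$1$1 + A$2$1) * (?s * ?t) + (A$1$2 + A$2$2) * (?s * (1 - ?t))"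
      unfolding matrix_vector_mult_nth_2 X[symmetric] by (simp add: algebra_simps)
    then show ?thesis by (simp only: mass_def distrib_left mult.left_commute)
  qed
  show "0 < (A *v X)$1 + (A *v X)$2" unfolding sum using assms(4) mass_pos[OF assms(1) t] by simp
  show "(A *v X)$1 / ((A *v X)$1 + (A *v X)$2) = act A ?t"
    unfolding sum unfolding num act_def using assms(4) by simp
qed

text \<open>The induction removes the last factor, which acts on the vector first; hence the vector
  is arbitrary.\<close>

lemma normalized_mprod:
  assumes "\<And>k. k \<in> {1..n} \<Longrightarrow> admissible (M (\<omega> k))" "0 \<le> X$1" "0 \<le> X$2" "0 < X$1 + X$2"
  shows "0 < (mprod M \<omega> n *v X)$1 + (mprod M \<omega> n *v X)$2
    \<and> normalized (mprod M \<omega> n *v X) $ 1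
      = foldr act (map (\<lambda>k. M (\<omega> k)) [1..<Suc n]) (X$1 / (X$1 + X$2))"
  using assms
proof (induction n arbitrary: X)
  case 0
  then show ?case by (simp add: normalized_nth_1)
next
  case (Suc n)
  have adm: "admissible (M (\<omega> (Suc n)))" using Suc.prems(1)[of "Suc n"] by simp
  note Y = admissible_mult_vector[OF adm Suc.prems(2-4)]
  have "mprod M \<omega> (Suc n) *v X = mprod M \<omega> n *v (M (\<omega> (Suc n)) *v X)"
    by (simp add: matrix_vector_mul_assoc)
  then show ?case using Suc.IH[OF _ Y(1-3)] Suc.prems(1) Y(4) by simp
qed

text \<open>Normalized coordinates add up to \<open>1\<close>, so both change by the same
  amount.\<close>

lemma dist_normalized:
  assumes "X$1 + X$2 \<noteq> 0" "Y$1 + Y$2 \<noteq> 0"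
  shows "\<bar>normalized X $ 1 - normalized Y $ 1\<bar> \<le> dist (normalized X) (normalized Y)"
    "dist (normalized X) (normalized Y) \<le> 2 * \<bar>normalized X $ 1 - normalized Y $ 1\<bar>"
proof -
  show "\<bar>normalized X $ 1 - normalized Y $ 1\<bar> \<le> dist (normalized X) (normalized Y)"
    using dist_vec_nth_le[of "normalized X" 1 "normalized Y"] by (simp add: dist_real_def)
  show "dist (normalized X) (normalized Y) \<le> 2 * \<bar>normalized X $ 1 - normalized Y $ 1\<bar>"
    unfolding dist_norm
    using norm_le_l1_cart[of "normalized X - normalized Y"] assms
    by (simp add: sum_2 normalized_nth_2 normalized_nth_1 abs_minus_commute)
qed

text \<open>Finite words are the prefixes of sequences, and completeness turns the uniform Cauchy
  condition into uniform convergence.\<close>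

lemma uniformly_convergent_iff_word_cauchy:
  fixes M :: "nat \<Rightarrow> real^2^2"
  assumes s: "s \<ge> 1" and adm: "\<And>i. i < s \<Longrightarrow> admissible (M i)" and V: "V$1 > 0" "V$2 > 0"
  shows "uniformly_convergent_on ({1..} \<rightarrow> {..<s}) (\<lambda>n \<omega>. normalized (mprod M \<omega> n *v V))
    \<longleftrightarrow> word_cauchy (M ` {..<s}) (V$1 / (V$1 + V$2))"
proof -
  let ?\<Omega> = "{1..} \<rightarrow> {..<s}" and ?f = "\<lambda>n \<omega>. normalized (mprod M \<omega> n *v V)"
  let ?t = "V$1 / (V$1 + V$2)" and ?w = "\<lambda>\<omega> n. map (\<lambda>k. M (\<omega> k)) [1..<Suc n]"
  have norm: "(mprod M \<omega> n *v V)$1 + (mprod M \<omega> n *v V)$2 \<noteq> 0" "?f n \<omega> $ 1 = foldr act (?w \<omega> n) ?t"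
    if "\<omega> \<in> ?\<Omega>" for \<omega> n
  proof -
    have "admissible (M (\<omega> k))" if "k \<in> {1..n}" for k
      using \<open>\<omega> \<in> ?\<Omega>\<close> that adm by (auto simp: Pi_iff)
    then show "(mprod M \<omega> n *v V)$1 + (mprod M \<omega> n *v V)$2 \<noteq> 0" "?f n \<omega> $ 1 = foldr act (?w \<omega> n) ?t"
      using normalized_mprod[of n M \<omega> V] V by auto
  qed
  show ?thesis
  proof
    assume "uniformly_convergent_on ?\<Omega> ?f"
    then have cauchy: "uniformly_Cauchy_on ?\<Omega> ?f" by (rule uniformly_convergent_Cauchy)
    show "word_cauchy (M ` {..<s}) ?t"
      unfolding word_cauchy_def
    proof (intro allI impI)
      fix e :: real assume "0 < e"
      then obtain N where N: "\<And>\<omega> m n. \<omega> \<in> ?\<Omega> \<Longrightarrow> N \<le> m \<Longrightarrow> N \<le> n \<Longrightarrow> dist (?f m \<omega>) (?f n \<omega>) < e"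
        using cauchy unfolding uniformly_Cauchy_on_def by blast
      have "\<bar>foldr act (u @ w) ?t - foldr act u ?t\<bar> < e"
        if uw: "u \<in> lists (M ` {..<s})" "w \<in> lists (M ` {..<s})" and Nu: "N \<le> length u" for u w
      proof -
        have "u @ w \<in> lists (M ` {..<s})" using uw by simp
        then obtain js where js: "js \<in> lists {..<s}" "u @ w = map M js"
          unfolding lists_image by blast
        \<comment> \<open>Sequences start at index \<open>1\<close>, lists at \<open>0\<close>.
          Beyond the word the letter is \<open>0\<close>, which lies in \<open>{..<s}\<close>
          because \<open>s \<ge> 1\<close>.\<close>
        define \<omega> where "\<omega> k = (if k - 1 < length js then js ! (k - 1) else 0)" for k
        have \<omega>: "\<omega> \<in> ?\<Omega>"
          using js(1) s by (auto simp: \<omega>_def in_lists_conv_set)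
        have w_eq: "?w \<omega> n = take n (u @ w)" if "n \<le> length (u @ w)" for n
        proof (rule nth_equalityI)
          have len: "length (u @ w) = length js" using js(2) by simp
          show "length (?w \<omega> n) = length (take n (u @ w))"
            using that by (simp del: length_append take_append upt_Suc)
          fix i assume "i < length (?w \<omega> n)"
          then have i: "i < n" by (simp del: upt_Suc)
          then show "?w \<omega> n ! i = take n (u @ w) ! i"
            using that len unfolding js(2) by (simp add: \<omega>_def nth_append del: upt_Suc)
        qed
        have "\<bar>?f (length (u @ w)) \<omega> $ 1 - ?f (length u) \<omega> $ 1\<bar>
            \<le> dist (?f (length (u @ w)) \<omega>) (?f (length u) \<omega>)"
          by (intro dist_normalized norm \<omega>)
        also have "\<dots> < e" by (rule N[OF \<omega>]) (use Nu in simp_all)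
        finally show ?thesis
          unfolding norm(2)[OF \<omega>] using w_eq[of "length (u @ w)"] w_eq[of "length u"] by simp
      qed
      then show "\<exists>N. \<forall>u\<in>lists (M ` {..<s}). \<forall>w\<in>lists (M ` {..<s}). N \<le> length u \<longrightarrow>
          \<bar>foldr act (u @ w) ?t - foldr act u ?t\<bar> < e" by blast
    qed
  next
    assume wc: "word_cauchy (M ` {..<s}) ?t"
    have "uniformly_Cauchy_on ?\<Omega> ?f"
    proof (rule uniformly_Cauchy_onI')
      fix e :: real assume "0 < e"
      \<comment> \<open>Halving pays for the factor \<open>2\<close> in
        \<open>dist_normalized\<close>.\<close>
      then have "0 < e / 2" by simp
      then obtain N where N: "\<And>u w. u \<in> lists (M ` {..<s}) \<Longrightarrow> w \<in> lists (M ` {..<s}) \<Longrightarrow>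
          N \<le> length u \<Longrightarrow> \<bar>foldr act (u @ w) ?t - foldr act u ?t\<bar> < e / 2"
        using wc unfolding word_cauchy_def by blast
      have "dist (?f m \<omega>) (?f n \<omega>) < e" if \<omega>: "\<omega> \<in> ?\<Omega>" and mn: "N \<le> m" "m < n" for \<omega> m n
      proof -
        have "[1..<Suc n] = [1..<Suc m] @ [Suc m..<Suc n]"
          using mn(2) upt_add_eq_append[of 1 "Suc m" "n - m"] by simp
        then have split: "?w \<omega> n = ?w \<omega> m @ map (\<lambda>k. M (\<omega> k)) [Suc m..<Suc n]" by simp
        have less: "\<bar>?f n \<omega> $ 1 - ?f m \<omega> $ 1\<bar> < e / 2"
          unfolding norm(2)[OF \<omega>] unfolding split using \<omega> mn(1)
          by (intro N) (auto simp: Pi_iff)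
        have "dist (?f n \<omega>) (?f m \<omega>) \<le> 2 * \<bar>?f n \<omega> $ 1 - ?f m \<omega> $ 1\<bar>"
          by (intro dist_normalized norm \<omega>)
        also have "\<dots> < e" using less by simp
        finally show ?thesis by (simp add: dist_commute)
      qed
      then show "\<exists>N. \<forall>\<omega>\<in>?\<Omega>. \<forall>m\<ge>N. \<forall>n>m. dist (?f m \<omega>) (?f n \<omega>) < e" by blast
    qed
    then show "uniformly_convergent_on ?\<Omega> ?f" by (rule Cauchy_uniformly_convergent)
  qed
qed

lemma eigenvector_iff_act_fixed:
  assumes "admissible A" "X$1 > 0" "X$2 > 0"
  shows "eigenvector A X \<longleftrightarrow> act A (X$1 / (X$1 + X$2)) = X$1 / (X$1 + X$2)"
proof -
  let ?Y = "A *v X"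
  have sX: "0 < X$1 + X$2" using assms by simp
  have "0 \<le> X$1" "0 \<le> X$2" using assms by auto
  note Y = admissible_mult_vector[OF assms(1) this sX]
  have "eigenvector A X \<longleftrightarrow> (\<exists>k. ?Y$1 = k * X$1 \<and> ?Y$2 = k * X$2)"
    using assms(2) by (auto simp: eigenvector_def vec_eq_iff forall_2)
  also have "\<dots> \<longleftrightarrow> ?Y$1 / (?Y$1 + ?Y$2) = X$1 / (X$1 + X$2)"
  proof
    assume "\<exists>k. ?Y$1 = k * X$1 \<and> ?Y$2 = k * X$2"
    then obtain k where k: "?Y$1 = k * X$1" "?Y$2 = k * X$2" by blast
    then have "k \<noteq> 0" using Y(3) by auto
    then show "?Y$1 / (?Y$1 + ?Y$2) = X$1 / (X$1 + X$2)"
      unfolding k by (simp flip: distrib_left)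
  next
    assume eq: "?Y$1 / (?Y$1 + ?Y$2) = X$1 / (X$1 + X$2)"
    \<comment> \<open>An eigenvalue must be the factor by which the coordinate sum changes.\<close>
    define k where "k = (?Y$1 + ?Y$2) / (X$1 + X$2)"
    have 1: "?Y$1 = k * X$1" using eq Y(3) sX by (simp add: k_def field_simps)
    have "?Y$1 + ?Y$2 = k * (X$1 + X$2)" using sX by (simp add: k_def)
    then have "?Y$2 = k * X$2" using 1 by (simp add: algebra_simps)
    with 1 show "\<exists>k. ?Y$1 = k * X$1 \<and> ?Y$2 = k * X$2" by blast
  qed
  finally show ?thesis unfolding Y(4) .
qed

theorem theorem1p1:
  fixes s :: nat and M :: "nat \<Rightarrow> real^2^2" and V :: "real^2"
  assumes "s \<ge> 1"
    and "\<And>i. i < s \<Longrightarrow> nonneg_matrix (M i)"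
    and "\<And>i. i < s \<Longrightarrow> column_allowable (M i)"
    and "V $ 1 > 0" and "V $ 2 > 0"
  shows "uniformly_convergent_on ({1..} \<rightarrow> {..<s}) (\<lambda>n \<omega>. normalized (mprod M \<omega> n *v V)) \<longleftrightarrow>
    case1 (M ` {..<s}) \<or> case2 (M ` {..<s}) \<or> case3 (M ` {..<s}) \<or> case4 (M ` {..<s}) \<or>
    case5 (M ` {..<s}) V"
proof -
  let ?t = "V$1 / (V$1 + V$2)"
  have adm: "admissible (M i)" if "i < s" for i
    using assms(2,3) that by (simp add: admissible_def)
  have t: "0 < ?t" "?t < 1" using assms(4,5) by simp_all
  have "case5 (M ` {..<s}) V \<longleftrightarrow> (\<forall>A\<in>M ` {..<s}. act A ?t = ?t)"
    unfolding case5_def using eigenvector_iff_act_fixed adm assms(4,5) by auto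
  moreover have "word_cauchy (M ` {..<s}) ?t \<longleftrightarrow> case1 (M ` {..<s}) \<or> case2 (M ` {..<s}) \<or>
      case3 (M ` {..<s}) \<or> case4 (M ` {..<s}) \<or> (\<forall>A\<in>M ` {..<s}. act A ?t = ?t)"
    by (rule word_cauchy_iff) (use adm t in auto)
  ultimately show ?thesis
    using uniformly_convergent_iff_word_cauchy[of s M V] assms(1,4,5) adm by simp
qed

end
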